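(* Let $\bar\delta_{\max}=0.0432863855$ and $0\le\bar\delta\le\bar\delta_{\max}$. Then the cubic polynomial $\mathcal P$ (defined in the context, depending on $\bar\delta$) has three nonnegative real roots $0\le\beta_*<\beta^*<\beta_3$. Suppose that $\beta\in(\beta_*,\beta^* )$ and $$\bar\Delta := \frac{\theta(1-\bar\delta-\beta)-\beta}{1+2\theta}>0,\qquad\text{where}\quad \theta := \frac{\sqrt{p^2+4q}-p}{2},$$ with $p := \bar\delta[(1-\bar\delta)^{-2}+2(1-\bar\delta)^{-1}]$ and $q := (1-\bar\delta)\beta-2\bar\delta$. Then, for $0\le\delta_+\le\bar\delta$, $0\le\delta_1\le\bar\delta$ and $0\le\Delta\le\bar\Delta$, if $\bar\lambda\le\beta$ then $\bar\lambda_+\le\beta$. (Here $\delta_+,\delta_1,\Delta,\bar\lambda,\bar\lambda_+$ are the quantities, defined in the context, attached to one step $(y,t)\mapsto(y_+,t_+)$ of the inexact perturbed full-step Newton path-following iteration.)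
   Context: Polynomial. $\mathcal P(\beta)=c_0+c_1\beta+c_2\beta^2+c_3\beta^3$ with $c_0=-2\bar\delta(1-\bar\delta)^2$, $c_1=(1-\bar\delta)[(1+\bar\delta)^2-p]$, $c_2=p-3-2\bar\delta^2+2\bar\delta$, $c_3=1-\bar\delta$, where $p=\bar\delta[(1-\bar\delta)^{-2}+2(1-\bar\delta)^{-1}]$. Setting of the iteration. $X_i\subset\mathbb{R}^{n_i}$ ($i=1,2$) is a bounded closed convex set with nonempty interior and $F_i$ is a $\nu_i$-self-concordant barrier for $X_i$ (standard self-concordant, i.e. $|D^3F_i(x)[h,h,h]|\le 2(h^T\nabla^2F_i(x)h)^{3/2}$, with domain $\mathrm{int}(X_i)$, tending to $+\infty$ at the boundary, and $(\nabla F_i(x)^Th)^2\le\nu_i\,h^T\nabla^2F_i(x)h$). $X=X_1\times X_2$, $F(x)=F_1(x_1)+F_2(x_2)$, $A=[A_1,A_2]\in\mathbb{R}^{m\times n}$ ($n=n_1+n_2$) has full row rank, $b\in\mathbb{R}^m$, $c\in\mathbb{R}^n$; the problem $\max\{c^Tx: Ax=b,\ x\in X\}$ has a solution, and either $\mathrm{ri}(X)\cap\{Ax=b\}\neq\emptyset$ or $X$ is polyhedral. $Y\subset\mathbb{R}^m$ is a bounded set containing the set of minimizers of the dual function $d_0(y)=\max_{x\in X}\{c^Tx+y^T(Ax-b)\}$. For $y\in\mathbb{R}^m$, $t>0$, $x^*(y,t)$ is the unique maximizer over $\mathrm{int}(X)$ of $c^Tx+y^T(Ax-b)-tF(x)$,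 and $\bar x_{\bar\delta}(y,t)\in\mathrm{int}(X)$ denotes an approximation of it. Norm: $\|u\|_x=(u^T\nabla^2F(x)u)^{1/2}$. Define (as notation; these are not actual derivatives) $\nabla d_{\bar\delta}(y,t)=A\bar x_{\bar\delta}(y,t)-b$, $\nabla^2d_{\bar\delta}(y,t)=\frac1tA\nabla^2F(\bar x_{\bar\delta}(y,t))^{-1}A^T$, and the inexact Newton decrement $\bar\lambda(y,t)=\left[\frac1t\nabla d_{\bar\delta}(y,t)^T\nabla^2d_{\bar\delta}(y,t)^{-1}\nabla d_{\bar\delta}(y,t)\right]^{1/2}$. One step of the iteration from $(y,t)$, $y\in Y$, $t>0$: $t_+=t-\Delta t$ with $\Delta t>0$, $t_+>0$, and $y_+=y-\nabla^2d_{\bar\delta}(y,t_+)^{-1}\nabla d_{\bar\delta}(y,t_+)$. Notation: $\bar\lambda=\bar\lambda(y,t)$, $\bar\lambda_+=\bar\lambda(y_+,t_+)$, $\delta_1=\|\bar x_{\bar\delta}(y,t_+)-x^*(y,t_+)\|_{x^*(y,t_+)}$, $\delta_+=\|\bar x_{\bar\delta}(y_+,t_+)-x^*(y_+,t_+)\|_{x^*(y_+,t_+)}$, $\Delta=\|\bar x_{\bar\delta}(y,t_+)-\bar x_{\bar\delta}(y,t)\|_{\bar x_{\bar\delta}(y,t)}$.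
   Formalization: The bound δ̄_max = 0.0432863855 is replaced by 0.043286385469: the printed value is the true threshold 0.04328638546928… rounded up, and at δ̄ = 0.0432863855 the cubic does not have three distinct real roots. *)

theory Defs
  imports "HOL-Analysis.Analysis"
begin

definition p_coef :: "real \<Rightarrow> real" where
  "p_coef \<delta> = \<delta> * (1 / (1 - \<delta>)^2 + 2 / (1 - \<delta>))"

definition q_coef :: "real \<Rightarrow> real \<Rightarrow> real" where
  "q_coef \<delta> \<beta> = (1 - \<delta>) * \<beta> - 2 * \<delta>"

definition theta :: "real \<Rightarrow> real \<Rightarrow> real" where
  "theta \<delta> \<beta> = (sqrt ((p_coef \<delta>)^2 + 4 * q_coef \<delta> \<beta>) - p_coef \<delta>) / 2"

definition Delta_bar :: "real \<Rightarrow> real \<Rightarrow> real" where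
  "Delta_bar \<delta> \<beta> = (theta \<delta> \<beta> * (1 - \<delta> - \<beta>) - \<beta>) / (1 + 2 * theta \<delta> \<beta>)"

definition cubic :: "real \<Rightarrow> real \<Rightarrow> real" where
  "cubic \<delta> \<beta> =
     - 2 * \<delta> * (1 - \<delta>)^2
     + (1 - \<delta>) * ((1 + \<delta>)^2 - p_coef \<delta>) * \<beta>
     + (p_coef \<delta> - 3 - 2 * \<delta>^2 + 2 * \<delta>) * \<beta>^2
     + (1 - \<delta>) * \<beta>^3"

(* The two smaller roots of the cubic merge at the threshold 0.04328638546928...
   The value 0.0432863855 printed in the literature is this threshold rounded upwards
   to ten decimals, and for it the three roots do not exist (see the lemma below).  We take
   the threshold truncated to twelve decimals instead. *)
definition delta_max :: real where
  "delta_max = 0.043286385469"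

lemma cubic_three_roots_discriminant:
  fixes c0 c1 c2 c3 x y z :: real
  assumes x: "c0 + c1 * x + c2 * x^2 + c3 * x^3 = 0"
    and y: "c0 + c1 * y + c2 * y^2 + c3 * y^3 = 0"
    and z: "c0 + c1 * z + c2 * z^2 + c3 * z^3 = 0"
    and ne: "x \<noteq> y" "y \<noteq> z" "x \<noteq> z"
  shows "18*c3*c2*c1*c0 - 4*c2^3*c0 + c2^2*c1^2 - 4*c3*c1^3 - 27*c3^2*c0^2 \<ge> 0"
proof -
  have "(x - y) * (c1 + c2 * (x + y) + c3 * (x^2 + x*y + y^2)) = 0"
    using x y by algebra
  then have xy: "c1 + c2 * (x + y) + c3 * (x^2 + x*y + y^2) = 0"
    using ne by simp
  have "(x - z) * (c1 + c2 * (x + z) + c3 * (x^2 + x*z + z^2)) = 0"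
    using x z by algebra
  then have xz: "c1 + c2 * (x + z) + c3 * (x^2 + x*z + z^2) = 0"
    using ne by simp
  have "(y - z) * (c2 + c3 * (x + y + z)) = 0"
    using xy xz by algebra
  then have c2: "c2 = - c3 * (x + y + z)"
    using ne by simp
  have c1: "c1 = c3 * (x*y + x*z + y*z)"
    using xy c2 by algebra
  have c0: "c0 = - c3 * (x*y*z)"
    using x c1 c2 by algebra
  let ?e1 = "x + y + z" and ?e2 = "x*y + x*z + y*z" and ?e3 = "x*y*z"
  have "18*?e1*?e2*?e3 - 4*?e1^3*?e3 + ?e1^2*?e2^2 - 4*?e2^3 - 27*?e3^2
        = ((x - y) * (y - z) * (x - z))^2"
    by algebra
  moreover have "18*c3*c2*c1*c0 - 4*c2^3*c0 + c2^2*c1^2 - 4*c3*c1^3 - 27*c3^2*c0^2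
        = c3^4 * (18*e1*e2*e3 - 4*e1^3*e3 + e1^2*e2^2 - 4*e2^3 - 27*e3^2)"
    if "c2 = - c3 * e1" "c1 = c3 * e2" "c0 = - c3 * e3" for e1 e2 e3
    unfolding that by algebra
  ultimately have "18*c3*c2*c1*c0 - 4*c2^3*c0 + c2^2*c1^2 - 4*c3*c1^3 - 27*c3^2*c0^2
        = c3^4 * ((x - y) * (y - z) * (x - z))^2"
    using c0 c1 c2 by metis
  then show ?thesis
    by simp
qed

lemma no_three_roots_at_rounded_threshold:
  "\<not> (\<exists>x y z. x < y \<and> y < z \<and>
        cubic 0.0432863855 x = 0 \<and> cubic 0.0432863855 y = 0 \<and> cubic 0.0432863855 z = 0)"
proof
  assume "\<exists>x y z. x < y \<and> y < z \<and>
        cubic 0.0432863855 x = 0 \<and> cubic 0.0432863855 y = 0 \<and> cubic 0.0432863855 z = 0"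
  then obtain x y z where lt: "x < y" "y < z"
    and r: "cubic 0.0432863855 x = 0" "cubic 0.0432863855 y = 0" "cubic 0.0432863855 z = 0"
    by blast
  from lt have ne: "x \<noteq> y" "y \<noteq> z" "x \<noteq> z"
    by auto
  (* clearing the denominators keeps the arithmetic on integers *)
  let ?K = "29289630085428947528000000000000000000000000000 :: real"
  let ?c0 = "- 2320914350130384397855147691147044445609345702 :: real"
  let ?c1 = "26639326410654343051437150039634854891195327149 :: real"
  let ?c2 = "- 81407390939176426799310957321861081924000000000 :: real"
  let ?c3 = "28021787866398672172443719956000000000000000000 :: real"
  have p: "p_coef 0.0432863855 = 504446936642763118 / 3661203760678618441"
    by (simp add: p_coef_def power2_eq_square)
  have k: "?K * (- 2 * 0.0432863855 * (1 - 0.0432863855)^2) = ?c0"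
    "?K * ((1 - 0.0432863855) * ((1 + 0.0432863855)^2 - p_coef 0.0432863855)) = ?c1"
    "?K * (p_coef 0.0432863855 - 3 - 2 * 0.0432863855^2 + 2 * 0.0432863855) = ?c2"
    "?K * (1 - 0.0432863855) = ?c3"
    unfolding p by (simp_all add: power2_eq_square)
  have scale: "k * (a + b * u + c * u^2 + d * u^3) = k * a + k * b * u + k * c * u^2 + k * d * u^3"
    for k a b c d u :: real
    by (simp only: distrib_left mult.assoc)
  have "?K * cubic 0.0432863855 u = ?c0 + ?c1 * u + ?c2 * u^2 + ?c3 * u^3" for u
    unfolding cubic_def k[symmetric] by (rule scale)
  then have "?c0 + ?c1 * u + ?c2 * u^2 + ?c3 * u^3 = 0" if "cubic 0.0432863855 u = 0" for u
    using that by (metis mult_zero_right)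
  from cubic_three_roots_discriminant[OF this this this, OF r ne]
  show False
    by (simp only: power2_eq_square power3_eq_cube arith_simps rel_simps)
qed

definition gradient :: "(real^'n \<Rightarrow> real) \<Rightarrow> real^'n \<Rightarrow> real^'n" where
  "gradient f x = (THE D. GDERIV f x :> D)"

definition hessian :: "(real^'n \<Rightarrow> real) \<Rightarrow> real^'n \<Rightarrow> real^'n^'n" where
  "hessian f x = matrix (frechet_derivative (gradient f) (at x))"

definition C3_on :: "(real^'n) set \<Rightarrow> (real^'n \<Rightarrow> real) \<Rightarrow> bool" where
  "C3_on S f \<longleftrightarrow>
     (\<forall>x\<in>S. f differentiable (at x)) \<and>
     (\<forall>x\<in>S. gradient f differentiable (at x)) \<and>
     (\<forall>x\<in>S. hessian f differentiable (at x)) \<and>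
     (\<forall>h. continuous_on S (\<lambda>x. frechet_derivative (hessian f) (at x) h))"

(* D^3 f(x)[h,h,h] *)
definition third_deriv :: "(real^'n \<Rightarrow> real) \<Rightarrow> real^'n \<Rightarrow> real^'n \<Rightarrow> real" where
  "third_deriv f x h = h \<bullet> (frechet_derivative (hessian f) (at x) h *v h)"

(* Self-concordant functions are by convention convex and three times continuously
   differentiable on their (open) domain; only the values of F on interior X matter. *)
definition self_concordant_barrier ::
    "(real^'n) set \<Rightarrow> real \<Rightarrow> (real^'n \<Rightarrow> real) \<Rightarrow> bool" where
  "self_concordant_barrier X \<nu> F \<longleftrightarrow>
     convex_on (interior X) F \<and> C3_on (interior X) F \<and>
     (\<forall>x\<in>interior X. \<forall>h.
        \<bar>third_deriv F x h\<bar> \<le> 2 * (h \<bullet> (hessian F x *v h)) powr (3/2)) \<and>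
     (\<forall>z\<in>frontier X. filterlim F at_top (at z within interior X)) \<and>
     (\<forall>x\<in>interior X. \<forall>h.
        (gradient F x \<bullet> h)^2 \<le> \<nu> * (h \<bullet> (hessian F x *v h)))"

definition local_norm :: "(real^'n \<Rightarrow> real) \<Rightarrow> real^'n \<Rightarrow> real^'n \<Rightarrow> real" where
  "local_norm F x u = sqrt (u \<bullet> (hessian F x *v u))"

(* R^(n1+n2) is indexed by the sum type; block1 and block2 are the components x_1 and x_2 *)
definition block1 :: "real^('n1::finite + 'n2::finite) \<Rightarrow> real^'n1" where
  "block1 x = (\<chi> i. x $ Inl i)"

definition block2 :: "real^('n1::finite + 'n2::finite) \<Rightarrow> real^'n2" where
  "block2 x = (\<chi> i. x $ Inr i)"

definition prod_set ::
    "(real^'n1) set \<Rightarrow> (real^'n2) set \<Rightarrow> (real^('n1::finite + 'n2::finite)) set" where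
  "prod_set X1 X2 = {x. block1 x \<in> X1 \<and> block2 x \<in> X2}"

definition sum_fun ::
    "(real^'n1 \<Rightarrow> real) \<Rightarrow> (real^'n2 \<Rightarrow> real) \<Rightarrow> real^('n1::finite + 'n2::finite) \<Rightarrow> real" where
  "sum_fun F1 F2 x = F1 (block1 x) + F2 (block2 x)"

definition lagrangian ::
    "real^'n^'m \<Rightarrow> real^'m \<Rightarrow> real^'n \<Rightarrow> real^'m \<Rightarrow> real^'n \<Rightarrow> real" where
  "lagrangian A b c y x = c \<bullet> x + y \<bullet> (A *v x - b)"

definition dual_fun ::
    "(real^'n) set \<Rightarrow> real^'n^'m \<Rightarrow> real^'m \<Rightarrow> real^'n \<Rightarrow> real^'m \<Rightarrow> real" where
  "dual_fun X A b c y = (SUP x\<in>X. lagrangian A b c y x)"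

definition x_star ::
    "(real^'n) set \<Rightarrow> (real^'n \<Rightarrow> real) \<Rightarrow> real^'n^'m \<Rightarrow> real^'m \<Rightarrow> real^'n
      \<Rightarrow> real^'m \<Rightarrow> real \<Rightarrow> real^'n" where
  "x_star X F A b c y t =
     (THE x. is_arg_max (\<lambda>x. lagrangian A b c y x - t * F x) (\<lambda>x. x \<in> interior X) x)"

(* In the following, xbar y t is the approximation of x_star at (y, t). *)
definition inexact_grad ::
    "real^'n^'m \<Rightarrow> real^'m \<Rightarrow> (real^'m \<Rightarrow> real \<Rightarrow> real^'n) \<Rightarrow> real^'m \<Rightarrow> real \<Rightarrow> real^'m" where
  "inexact_grad A b xbar y t = A *v xbar y t - b"

definition inexact_hess ::
    "(real^'n \<Rightarrow> real) \<Rightarrow> real^'n^'m \<Rightarrow> (real^'m \<Rightarrow> real \<Rightarrow> real^'n)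
      \<Rightarrow> real^'m \<Rightarrow> real \<Rightarrow> real^'m^'m" where
  "inexact_hess F A xbar y t =
     (1 / t) *\<^sub>R (A ** matrix_inv (hessian F (xbar y t)) ** transpose A)"

definition inexact_decrement ::
    "(real^'n \<Rightarrow> real) \<Rightarrow> real^'n^'m \<Rightarrow> real^'m \<Rightarrow> (real^'m \<Rightarrow> real \<Rightarrow> real^'n)
      \<Rightarrow> real^'m \<Rightarrow> real \<Rightarrow> real" where
  "inexact_decrement F A b xbar y t =
     sqrt ((1 / t) * (inexact_grad A b xbar y t \<bullet>
       (matrix_inv (inexact_hess F A xbar y t) *v inexact_grad A b xbar y t)))"

definition newton_step ::
    "(real^'n \<Rightarrow> real) \<Rightarrow> real^'n^'m \<Rightarrow> real^'m \<Rightarrow> (real^'m \<Rightarrow> real \<Rightarrow> real^'n)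
      \<Rightarrow> real^'m \<Rightarrow> real \<Rightarrow> real^'m" where
  "newton_step F A b xbar y t =
     y - matrix_inv (inexact_hess F A xbar y t) *v inexact_grad A b xbar y t"

definition decomposition_setting ::
    "(real^'n1) set \<Rightarrow> (real^'n2) set \<Rightarrow> (real^'n1 \<Rightarrow> real) \<Rightarrow> (real^'n2 \<Rightarrow> real)
      \<Rightarrow> real \<Rightarrow> real \<Rightarrow> real^('n1::finite + 'n2::finite)^'m \<Rightarrow> real^'m \<Rightarrow> real^('n1::finite + 'n2::finite)
      \<Rightarrow> (real^'m) set \<Rightarrow> bool" where
  "decomposition_setting X1 X2 F1 F2 \<nu>1 \<nu>2 A b c Y \<longleftrightarrow>
     bounded X1 \<and> closed X1 \<and> convex X1 \<and> interior X1 \<noteq> {} \<and>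
     bounded X2 \<and> closed X2 \<and> convex X2 \<and> interior X2 \<noteq> {} \<and>
     self_concordant_barrier X1 \<nu>1 F1 \<and> self_concordant_barrier X2 \<nu>2 F2 \<and>
     rank A = CARD('m) \<and>
     (\<exists>x. is_arg_max (\<lambda>x. c \<bullet> x) (\<lambda>x. A *v x = b \<and> x \<in> prod_set X1 X2) x) \<and>
     (rel_interior (prod_set X1 X2) \<inter> {x. A *v x = b} \<noteq> {} \<or> polyhedron (prod_set X1 X2)) \<and>
     bounded Y \<and>
     {y. \<forall>z. dual_fun (prod_set X1 X2) A b c y \<le> dual_fun (prod_set X1 X2) A b c z} \<subseteq> Y"

end

theory Submission
  imports Defs
begin

text \<open>
  The inexact decrement at a point \<open>x\<close> is the distance, in the local norm of \<open>x\<close>, from \<open>x\<close>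
  to the affine space of all \<open>z\<close> with \<open>A z = b\<close>: the matrix \<open>A (\<nabla>\<^sup>2F(x))\<^sup>-\<^sup>1 A\<^sup>T\<close> in its definition
  is the Gram matrix of a least-norm problem (\<open>inexact_decrement_direction\<close>).  Any
  feasible point therefore bounds the decrement from above, and the proof consists of the choice
  of good feasible points and of the comparison of local norms at the points involved.

  Changing \<open>t\<close> to \<open>t\<^sub>+\<close> moves the approximate maximizer by \<open>\<Delta>\<close>, which turns a decrement
  of at most \<open>\<beta>\<close> into one of at most \<open>l\<close> with \<open>l (1 - \<Delta>) \<le> \<beta> + \<Delta>\<close>.  Let \<open>a\<close> be the approximation at
  \<open>(y, t\<^sub>+)\<close> and \<open>u\<close> the shortest vector for which \<open>a + u\<close> is feasible.  The Newton step is exactly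
  the one for which \<open>\<nabla>\<^sup>2F(a) u\<close> is the change of \<open>\<nabla>F\<close> from the exact maximizer at
  \<open>(y, t\<^sub>+)\<close> to the one at \<open>(y\<^sub>+, t\<^sub>+)\<close>.  Hence \<open>u\<close> is a linearization, with a slightly wrong Hessian, of the map that
  sends a gradient to the point where it is attained, and \<open>a + u\<close> misses the exact maximizer at \<open>(y\<^sub>+, t\<^sub>+)\<close> only by
  the inexactness \<open>\<delta>\<close> and by a second-order term.  With \<open>\<theta>\<^sub>1 = l / (1 - \<delta> - l)\<close> and \<open>\<lambda>\<^sub>+\<close> the new decrement this gives
  \<open>(1 - \<delta>) \<lambda>\<^sub>+ \<le> 2 \<delta> + p \<theta>\<^sub>1 + \<theta>\<^sub>1\<^sup>2\<close> (\<open>inexact_newton_estimate\<close>).  The number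
  \<open>theta \<delta> \<beta>\<close> is the positive root of \<open>\<theta>\<^sup>2 + p \<theta> = (1 - \<delta>) \<beta> - 2 \<delta>\<close>, and the bound on \<open>\<Delta>\<close> is what
  makes \<open>\<theta>\<^sub>1 \<le> theta \<delta> \<beta>\<close> true, so the right-hand side is at most \<open>(1 - \<delta>) \<beta>\<close>.

  The sharp constants require the linearization to be followed along the curve on which the
  gradient, not the point, moves at constant speed (\<open>dual_path\<close>).  Both on this curve and on straight
  segments self-concordance keeps the derivative of the reciprocal speed between \<open>-1\<close> and \<open>1\<close>, which yields the
  comparison of local norms by factors \<open>1 - \<rho>\<close> (\<open>N_comparison_along_path\<close>).  Here the bound on
  the third derivative is needed for two different directions, although it is assumed only for
  equal ones; the passage between the two is a statement on cubic forms in the plane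
  (\<open>cubic_form_bound\<close>).

  The cubic is \<open>q (1 - \<delta> - \<beta>)\<^sup>2 - \<beta>\<^sup>2 - p \<beta> (1 - \<delta> - \<beta>)\<close>, whose positivity is, for \<open>0 < \<beta> < 1 - \<delta>\<close>, the
  condition that some \<open>\<Delta> > 0\<close> is admissible.  It is nonpositive at \<open>0\<close>, positive at \<open>0.1804255\<close>, negative
  at \<open>1 - \<delta>\<close> and positive at \<open>4\<close>, which separates its three roots.
\<close>

section \<open>The cubic and the admissible step size\<close>

lemma cubic_eq:
  "cubic \<delta> \<beta> = q_coef \<delta> \<beta> * (1 - \<delta> - \<beta>)^2 - \<beta>^2 - p_coef \<delta> * \<beta> * (1 - \<delta> - \<beta>)"
  unfolding cubic_def q_coef_def by algebra

text \<open>
  The quotient \<open>p_coef \<delta> / \<delta>\<close> increases with \<open>\<delta>\<close>; the constant is its value at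
  \<open>delta_max\<close>, rounded up in the eleventh decimal.  In the next lemma the rounding error of about \<open>10\<^sup>-\<^sup>1\<^sup>2\<close> is multiplied
  by a number below \<open>0.01\<close>.
\<close>

lemma p_coef_le:
  assumes "0 \<le> \<delta>" "\<delta> \<le> delta_max"
  shows "p_coef \<delta> \<le> 3.18302658832 * \<delta>"
proof -
  have d: "1 - \<delta> \<ge> 1 - delta_max" "1 - delta_max > 0"
    using assms by (auto simp: delta_max_def)
  have "1 / (1 - \<delta>)^2 \<le> 1 / (1 - delta_max)^2"
    using d by (intro divide_left_mono power_mono mult_pos_pos zero_less_power) auto
  moreover have "2 / (1 - \<delta>) \<le> 2 / (1 - delta_max)"
    using d by (intro divide_left_mono mult_pos_pos) auto
  moreover have "1 / (1 - delta_max)^2 + 2 / (1 - delta_max) \<le> 3.18302658832"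
    by (simp add: delta_max_def power2_eq_square)
  ultimately have "1 / (1 - \<delta>)^2 + 2 / (1 - \<delta>) \<le> 3.18302658832"
    by linarith
  from mult_left_mono[OF this assms(1)] show ?thesis
    unfolding p_coef_def by (simp add: mult.commute)
qed

text \<open>
  At \<open>delta_max\<close> the two smaller roots almost coincide, near \<open>0.1804255\<close>, and the
  maximum of the cubic between them is only about \<open>5 * 10\<^sup>-\<^sup>1\<^sup>3\<close>.  With \<open>p_coef \<delta>\<close> replaced by its linear
  upper bound, the value of the cubic at this fixed point decreases in \<open>\<delta>\<close>, so one evaluation at
  \<open>delta_max\<close> settles all \<open>\<delta>\<close>.
\<close>

lemma cubic_pos_near_double_root:
  assumes "0 \<le> \<delta>" "\<delta> \<le> delta_max"
  shows "cubic \<delta> 0.1804255 > 0"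
proof -
  let ?b = "0.1804255 :: real" and ?K = "3.18302658832 :: real"
  \<comment> \<open>Stated for symbols \<open>b\<close> and \<open>K\<close>, so that the simplifier does not multiply out long numerals.\<close>
  have expand: "cubic \<delta> b = (b - 3 * b^2 + b^3)
      + (- 2 + b + 2 * b^2 - b^3 - K * b * (1 - b)) * \<delta> + (4 - b - 2 * b^2 + K * b) * \<delta>^2
      + (- 2 - b) * \<delta>^3 + K * \<delta> * (b * (1 - \<delta> - b)) - p_coef \<delta> * (b * (1 - \<delta> - b))"
    for b K
    unfolding cubic_def by (simp add: algebra_simps power2_eq_square power3_eq_cube)
  define a0 where "a0 = ?b - 3 * ?b^2 + ?b^3"
  define a1 where "a1 = - 2 + ?b + 2 * ?b^2 - ?b^3 - ?K * ?b * (1 - ?b)"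
  define a2 where "a2 = 4 - ?b - 2 * ?b^2 + ?K * ?b"
  define a3 where "a3 = - 2 - ?b"
  define Q where "Q d = a0 + a1 * d + a2 * d^2 + a3 * d^3" for d
  have dm: "\<delta> \<le> 0.05" "delta_max = 0.043286385469" "0 \<le> delta_max"
    using assms by (auto simp: delta_max_def)
  have "p_coef \<delta> * (?b * (1 - \<delta> - ?b)) \<le> ?K * \<delta> * (?b * (1 - \<delta> - ?b))"
    using p_coef_le[OF assms] dm by (intro mult_right_mono) auto
  moreover have "cubic \<delta> ?b = Q \<delta> + ?K * \<delta> * (?b * (1 - \<delta> - ?b)) - p_coef \<delta> * (?b * (1 - \<delta> - ?b))"
    unfolding Q_def a0_def a1_def a2_def a3_def by (rule expand)
  moreover have "w \<le> z" if "x \<le> y" "z = w + y - x" for w x y z :: real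
    using that by simp
  ultimately have "cubic \<delta> ?b \<ge> Q \<delta>" by blast
  moreover have "Q \<delta> \<ge> Q delta_max"
  proof -
    have "Q \<delta> - Q delta_max = (delta_max - \<delta>) *
        (- a1 - a2 * (\<delta> + delta_max) - a3 * (\<delta>^2 + \<delta> * delta_max + delta_max^2))"
      unfolding Q_def by algebra
    moreover have "- a1 - a2 * (\<delta> + delta_max) \<ge> 0"
    proof -
      have "a2 * (\<delta> + delta_max) \<le> a2 * (2 * delta_max)"
        using assms by (intro mult_left_mono) (auto simp: a2_def power2_eq_square)
      moreover have "a2 * (2 * delta_max) \<le> - a1"
        by (simp add: dm(2) a1_def a2_def power2_eq_square power3_eq_cube)
      ultimately show ?thesis by linarith
    qed
    moreover have "- a3 * (\<delta>^2 + \<delta> * delta_max + delta_max^2) \<ge> 0"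
      using assms dm by (intro mult_nonneg_nonneg add_nonneg_nonneg) (auto simp: a3_def)
    ultimately have "Q \<delta> - Q delta_max \<ge> 0"
      using assms(2) by simp
    then show ?thesis by simp
  qed
  moreover have "Q delta_max > 0"
    unfolding Q_def a0_def a1_def a2_def a3_def delta_max_def
    by (simp add: power2_eq_square power3_eq_cube)
  ultimately show ?thesis by (metis less_le_trans order_trans)
qed

text \<open>
  The intermediate value theorem gives a root in each of three adjacent intervals, and a cubic with
  three distinct roots is the product of its linear factors.  The bound \<open>hi < 1 - \<delta>\<close> comes from the
  negative value \<open>- (1 - \<delta>)\<^sup>2\<close> at \<open>1 - \<delta>\<close>.
\<close>

lemma cubic_three_roots:
  assumes "0 \<le> \<delta>" "\<delta> \<le> delta_max"
  obtains lo hi r where "0 \<le> lo" "lo < hi" "hi < 1 - \<delta>" "hi < r"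
    "{\<beta>. cubic \<delta> \<beta> = 0} = {lo, hi, r}" "\<And>\<beta>. lo < \<beta> \<Longrightarrow> \<beta> < hi \<Longrightarrow> cubic \<delta> \<beta> > 0"
proof -
  let ?b = "0.1804255 :: real"
  have d: "\<delta> \<le> 0.05"
    using assms by (auto simp: delta_max_def)
  have cont: "continuous_on S (cubic \<delta>)" for S
    unfolding cubic_def by (intro continuous_intros)
  have b: "cubic \<delta> ?b > 0"
    by (rule cubic_pos_near_double_root[OF assms])
  have "cubic \<delta> 0 \<le> 0"
    using assms by (simp add: cubic_def)
  with b obtain lo where lo: "0 \<le> lo" "lo \<le> ?b" "cubic \<delta> lo = 0"
    using IVT'[of "cubic \<delta>" 0 0 ?b] cont by auto
  have neg: "cubic \<delta> (1 - \<delta>) < 0"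
    using d by (simp add: cubic_eq)
  with b obtain hi where hi: "?b \<le> hi" "hi \<le> 1 - \<delta>" "cubic \<delta> hi = 0"
    using IVT2'[of "cubic \<delta>" "1 - \<delta>" 0 ?b] cont d by auto
  have "cubic \<delta> 4 > 0"
  proof -
    have "3.18302658832 * \<delta> \<le> 3.2 * \<delta>"
      using assms by (intro mult_right_mono) auto
    then have "p_coef \<delta> \<le> 3.2 * \<delta>"
      using p_coef_le[OF assms] by (rule order_trans[rotated])
    then have "p_coef \<delta> * (4 * (1 - \<delta> - 4)) \<ge> 3.2 * \<delta> * (4 * (1 - \<delta> - 4))"
      using assms by (intro mult_right_mono_neg) auto
    moreover have "p_coef \<delta> \<ge> 0"
      using assms d by (simp add: p_coef_def)
    then have "p_coef \<delta> * (4 * (1 - \<delta> - 4)) \<le> 0"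
      using assms by (intro mult_nonneg_nonpos) auto
    moreover have "q_coef \<delta> 4 \<ge> 3"
      using d by (simp add: q_coef_def)
    then have "q_coef \<delta> 4 * (1 - \<delta> - 4)^2 \<ge> 3 * 3^2"
      using assms d power_mono[of 3 "3 + \<delta>" 2] by (intro mult_mono) (auto simp: power2_eq_square algebra_simps)
    ultimately show ?thesis
      unfolding cubic_eq by (simp add: mult.assoc)
  qed
  with neg obtain r where r: "1 - \<delta> \<le> r" "cubic \<delta> r = 0"
    using IVT'[of "cubic \<delta>" "1 - \<delta>" 0 4] cont assms by auto
  have ne: "lo \<noteq> ?b" "hi \<noteq> ?b" "hi \<noteq> 1 - \<delta>" "r \<noteq> 1 - \<delta>"
    using lo(3) hi(3) r(2) b neg by (metis less_irrefl)+
  then have lt: "lo < hi" "hi < 1 - \<delta>" "hi < r"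
    using lo hi r by auto
  have fact: "cubic \<delta> \<beta> = (1 - \<delta>) * (\<beta> - lo) * (\<beta> - hi) * (\<beta> - r)" for \<beta>
  proof -
    define a0 a1 a2 a3 where a: "a0 = - 2 * \<delta> * (1 - \<delta>)^2"
      "a1 = (1 - \<delta>) * ((1 + \<delta>)^2 - p_coef \<delta>)"
      "a2 = p_coef \<delta> - 3 - 2 * \<delta>^2 + 2 * \<delta>" "a3 = 1 - \<delta>"
    have c: "cubic \<delta> x = a0 + a1 * x + a2 * x^2 + a3 * x^3" for x
      by (simp add: cubic_def a)
    have "(lo - hi) * (a1 + a2 * (lo + hi) + a3 * (lo^2 + lo * hi + hi^2)) = 0"
      using lo(3) hi(3) unfolding c by algebra
    then have 1: "a1 + a2 * (lo + hi) + a3 * (lo^2 + lo * hi + hi^2) = 0"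
      using lt by simp
    have "(lo - r) * (a1 + a2 * (lo + r) + a3 * (lo^2 + lo * r + r^2)) = 0"
      using lo(3) r(2) unfolding c by algebra
    then have 2: "a1 + a2 * (lo + r) + a3 * (lo^2 + lo * r + r^2) = 0"
      using lt by simp
    have "(hi - r) * (a2 + a3 * (lo + hi + r)) = 0"
      using 1 2 by algebra
    then have "a2 = - a3 * (lo + hi + r)"
      using lt by simp
    moreover from this have "a1 = a3 * (lo * hi + lo * r + hi * r)"
      using 1 by algebra
    moreover from calculation have "a0 = - a3 * (lo * hi * r)"
      using lo(3) unfolding c by algebra
    ultimately have "cubic \<delta> \<beta> = a3 * (\<beta> - lo) * (\<beta> - hi) * (\<beta> - r)"
      unfolding c by algebra
    then show ?thesis by (simp add: a)
  qed
  show ?thesis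
  proof (rule that[of lo hi r])
    show "{\<beta>. cubic \<delta> \<beta> = 0} = {lo, hi, r}"
      using d by (auto simp: fact)
    show "cubic \<delta> \<beta> > 0" if "lo < \<beta>" "\<beta> < hi" for \<beta>
    proof -
      have "(1 - \<delta>) * (\<beta> - lo) * ((hi - \<beta>) * (r - \<beta>)) > 0"
        using that lt d by (intro mult_pos_pos) auto
      also have "(1 - \<delta>) * (\<beta> - lo) * ((hi - \<beta>) * (r - \<beta>)) = cubic \<delta> \<beta>"
        unfolding fact by algebra
      finally show ?thesis .
    qed
  qed (use lo lt in auto)
qed

text \<open>
  Positivity of the cubic forces \<open>q_coef \<delta> \<beta> > 0\<close>, so that the square root is the real one and
  \<open>theta \<delta> \<beta>\<close> is the positive root of its quadratic equation.
\<close>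

lemma theta_properties:
  assumes \<delta>: "0 \<le> \<delta>" "\<delta> < 1" and \<beta>: "0 < \<beta>" "\<beta> < 1 - \<delta>" and pos: "cubic \<delta> \<beta> > 0"
  shows "theta \<delta> \<beta> > 0" "(theta \<delta> \<beta>)^2 + p_coef \<delta> * theta \<delta> \<beta> = q_coef \<delta> \<beta>"
proof -
  have p: "p_coef \<delta> \<ge> 0"
    using \<delta> by (simp add: p_coef_def)
  have "0 \<le> p_coef \<delta> * \<beta> * (1 - \<delta> - \<beta>)"
    using p \<beta> by simp
  then have "q_coef \<delta> \<beta> * (1 - \<delta> - \<beta>)^2 > 0"
    using pos zero_le_power2[of \<beta>] unfolding cubic_eq by linarith
  then have q: "q_coef \<delta> \<beta> > 0"
    by (simp add: zero_less_mult_iff)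
  let ?s = "sqrt ((p_coef \<delta>)^2 + 4 * q_coef \<delta> \<beta>)"
  have s: "?s^2 = (p_coef \<delta>)^2 + 4 * q_coef \<delta> \<beta>"
    using q by simp
  have "p_coef \<delta> < ?s"
    using q p by (intro real_less_rsqrt) simp
  then show "theta \<delta> \<beta> > 0"
    by (simp add: theta_def)
  have half: "t^2 + p * t = (s^2 - p^2) / 4" if "t = (s - p) / 2" for s p t :: real
    unfolding that by (simp add: power2_eq_square field_simps)
  have "theta \<delta> \<beta> = (?s - p_coef \<delta>) / 2"
    by (simp add: theta_def)
  then have "(theta \<delta> \<beta>)^2 + p_coef \<delta> * theta \<delta> \<beta> = (?s^2 - (p_coef \<delta>)^2) / 4"
    by (rule half)
  then show "(theta \<delta> \<beta>)^2 + p_coef \<delta> * theta \<delta> \<beta> = q_coef \<delta> \<beta>"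
    unfolding s by simp
qed

text \<open>
  The bound on \<open>D\<close> is equivalent to \<open>\<beta> + D \<le> theta \<delta> \<beta> * (1 - \<delta> - \<beta> - 2 * D)\<close>.  Since \<open>l\<close>
  is at most \<open>(\<beta> + D) / (1 - D)\<close>, the quotient in question is at most
  \<open>(\<beta> + D) / (1 - \<delta> - \<beta> - 2 * D)\<close>.
\<close>

lemma step_bound_le_theta:
  assumes \<delta>: "0 \<le> \<delta>" "\<delta> < 1" and \<beta>: "0 < \<beta>" "\<beta> < 1 - \<delta>" and \<theta>: "theta \<delta> \<beta> > 0"
    and D: "0 \<le> D" "D \<le> Delta_bar \<delta> \<beta>"
    and l: "0 \<le> l" "l * (1 - D) \<le> \<beta> + D"
  shows "D < 1" "l < 1 - \<delta>" "l / (1 - \<delta> - l) \<le> theta \<delta> \<beta>"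
proof -
  let ?t = "theta \<delta> \<beta>"
  have "D * (1 + 2 * ?t) \<le> ?t * (1 - \<delta> - \<beta>) - \<beta>"
    using D(2) \<theta> unfolding Delta_bar_def by (simp add: pos_le_divide_eq)
  then have main: "\<beta> + D \<le> ?t * (1 - \<delta> - \<beta> - 2 * D)"
    by (simp add: algebra_simps)
  then have "0 < ?t * (1 - \<delta> - \<beta> - 2 * D)"
    using \<beta> D by linarith
  then have den: "0 < 1 - \<delta> - \<beta> - 2 * D"
    using \<theta> by (simp add: zero_less_mult_iff)
  then show D1: "D < 1"
    using \<delta> \<beta> D by linarith
  have dD: "0 \<le> \<delta> * D"
    using \<delta> D by simp
  have *: "1 - \<delta> - \<beta> - 2 * D \<le> (1 - \<delta> - l) * (1 - D)"
    using l(2) dD by (simp add: algebra_simps)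
  then have "0 < (1 - \<delta> - l) * (1 - D)"
    using den by linarith
  then show l1: "l < 1 - \<delta>"
    using D1 by (simp add: zero_less_mult_iff)
  have "l * (1 - D) \<le> ?t * ((1 - \<delta> - l) * (1 - D))"
    using l(2) main mult_left_mono[OF *, of ?t] \<theta> by linarith
  then have "l * (1 - D) \<le> (?t * (1 - \<delta> - l)) * (1 - D)"
    by (simp only: mult.assoc)
  then have "l \<le> ?t * (1 - \<delta> - l)"
    using D1 by (simp add: mult_le_cancel_right)
  then show "l / (1 - \<delta> - l) \<le> ?t"
    using l1 by (simp add: pos_divide_le_eq)
qed

section \<open>Cubic forms in the plane\<close>

text \<open>
  A quadrature formula: the left-hand side, as a functional of the form, is a convex combination of
  its values at three points of the unit circle that differ by rotations by 120 degrees, the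
  first of which lies at a third of the angle of the direction at which the bound is wanted.  The second
  coordinate is divided by \<open>\<surd>3\<close>, which makes these rotations rational.  The weights
  \<open>(x\<^sup>2 - y\<^sup>2)\<^sup>2\<close> are squares, and they sum to 1.
\<close>

lemma cubic_form_bound_rescaled:
  fixes a b c d M C w :: real
  defines "f x y \<equiv> a * x^3 + 3 * b * x^2 * y + 9 * c * x * y^2 + 3 * d * y^3"
  assumes f: "\<And>x y. x^2 + 3 * y^2 = 1 \<Longrightarrow> f x y \<le> M" and 1: "C^2 + 3 * w^2 = 1"
  shows "a * (C^3 - 9 * C * w^2) + 3 * b * (C^2 * w - w^3) \<le> M"
proof -
  let ?x1 = "(- C - 3 * w) / 2" and ?y1 = "(C - w) / 2"
  let ?x2 = "(- C + 3 * w) / 2" and ?y2 = "(- C - w) / 2"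
  have n: "?x1^2 + 3 * ?y1^2 = 1" "?x2^2 + 3 * ?y2^2 = 1"
    using 1 by (simp_all add: power2_eq_square field_simps)
  have g: "(C^2 - w^2)^2 + (?x1^2 - ?y1^2)^2 + (?x2^2 - ?y2^2)^2 = 1"
  proof -
    have "(C^2 - w^2)^2 + (?x1^2 - ?y1^2)^2 + (?x2^2 - ?y2^2)^2 = (C^2 + 3 * w^2)^2"
      by (simp add: power2_eq_square field_simps)
    then show ?thesis using 1 by simp
  qed
  have A: "(C^2 - w^2)^2 * C^3 + (?x1^2 - ?y1^2)^2 * ?x1^3 + (?x2^2 - ?y2^2)^2 * ?x2^3
      = (C^2 + 3 * w^2)^2 * (C^3 - 9 * C * w^2)"
    by (simp add: power2_eq_square power3_eq_cube field_simps)
  have B: "(C^2 - w^2)^2 * (C^2 * w) + (?x1^2 - ?y1^2)^2 * (?x1^2 * ?y1) + (?x2^2 - ?y2^2)^2 * (?x2^2 * ?y2)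
      = (C^2 + 3 * w^2)^2 * (C^2 * w - w^3)"
    by (simp add: power2_eq_square power3_eq_cube field_simps)
  have C: "(C^2 - w^2)^2 * (C * w^2) + (?x1^2 - ?y1^2)^2 * (?x1 * ?y1^2) + (?x2^2 - ?y2^2)^2 * (?x2 * ?y2^2) = 0"
    by (simp add: power2_eq_square power3_eq_cube field_simps)
  have D: "(C^2 - w^2)^2 * w^3 + (?x1^2 - ?y1^2)^2 * ?y1^3 + (?x2^2 - ?y2^2)^2 * ?y2^3 = 0"
    by (simp add: power2_eq_square power3_eq_cube field_simps)
  have "(C^2 - w^2)^2 * f C w + (?x1^2 - ?y1^2)^2 * f ?x1 ?y1 + (?x2^2 - ?y2^2)^2 * f ?x2 ?y2
      = a * ((C^2 - w^2)^2 * C^3 + (?x1^2 - ?y1^2)^2 * ?x1^3 + (?x2^2 - ?y2^2)^2 * ?x2^3)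
      + 3 * b * ((C^2 - w^2)^2 * (C^2 * w) + (?x1^2 - ?y1^2)^2 * (?x1^2 * ?y1) + (?x2^2 - ?y2^2)^2 * (?x2^2 * ?y2))
      + 9 * c * ((C^2 - w^2)^2 * (C * w^2) + (?x1^2 - ?y1^2)^2 * (?x1 * ?y1^2) + (?x2^2 - ?y2^2)^2 * (?x2 * ?y2^2))
      + 3 * d * ((C^2 - w^2)^2 * w^3 + (?x1^2 - ?y1^2)^2 * ?y1^3 + (?x2^2 - ?y2^2)^2 * ?y2^3)"
    unfolding f_def by (simp only: distrib_left mult.assoc mult.left_commute add_ac)
  then have "a * (C^3 - 9 * C * w^2) + 3 * b * (C^2 * w - w^3)
      = (C^2 - w^2)^2 * f C w + (?x1^2 - ?y1^2)^2 * f ?x1 ?y1 + (?x2^2 - ?y2^2)^2 * f ?x2 ?y2"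
    unfolding A B C D 1 by simp
  also have "\<dots> \<le> (C^2 - w^2)^2 * M + (?x1^2 - ?y1^2)^2 * M + (?x2^2 - ?y2^2)^2 * M"
    using f[OF 1] f[OF n(1)] f[OF n(2)] by (intro add_mono mult_left_mono) auto
  also have "\<dots> = M"
    using g by (simp only: distrib_right[symmetric] mult_1_left)
  finally show ?thesis .
qed

text \<open>
  A symmetric trilinear form \<open>T\<close> on the plane with \<open>T(z,z,z) \<le> M\<close> for all unit vectors \<open>z\<close> also
  satisfies \<open>T(w,e,e) \<le> M\<close> for unit vectors \<open>w = (u, v)\<close> and \<open>e = (1, 0)\<close>.
\<close>

lemma cubic_form_bound:
  fixes a b c d M u v :: real
  assumes f: "\<And>x y. x^2 + y^2 = 1 \<Longrightarrow> a * x^3 + 3 * b * x^2 * y + 3 * c * x * y^2 + d * y^3 \<le> M"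
    and uv: "u^2 + v^2 = 1"
  shows "a * u + b * v \<le> M"
proof -
  obtain t where t: "u = cos t" "v = sin t"
    using sincos_total_2pi[OF uv] by metis
  define C w where "C = cos (t / 3)" and "w = sin (t / 3) / sqrt 3"
  have w: "sin (t / 3) = sqrt 3 * w"
    by (simp add: w_def)
  have 1: "C^2 + 3 * w^2 = 1"
    by (simp add: C_def w_def power_divide)
  have s2: "sqrt 3 * sqrt 3 = 3" by simp
  have u: "u = C^3 - 9 * C * w^2"
  proof -
    have "u = cos (3 * (t / 3))" using t by simp
    also have "\<dots> = 4 * C^3 - 3 * C"
      unfolding cos_treble_cos C_def ..
    also have "\<dots> = 4 * C^3 - 3 * C * (C^2 + 3 * w^2)" using 1 by simp
    finally show ?thesis by (simp add: power2_eq_square power3_eq_cube algebra_simps)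
  qed
  have v: "v = 3 * sqrt 3 * (C^2 * w - w^3)"
  proof -
    have "v = sin (3 * (t / 3))" using t by simp
    also have "\<dots> = sin (2 * (t / 3) + t / 3)" by simp
    also have "\<dots> = 3 * (C^2 * (sqrt 3 * w)) - (sqrt 3 * w)^3"
      unfolding sin_add sin_double cos_double w C_def[symmetric]
      by (simp add: power2_eq_square power3_eq_cube algebra_simps)
    also have "(sqrt 3 * w)^3 = 3 * sqrt 3 * w^3"
      using s2 by (simp add: power3_eq_cube algebra_simps)
    finally show ?thesis by (simp add: algebra_simps)
  qed
  have "a * (C^3 - 9 * C * w^2) + 3 * (sqrt 3 * b) * (C^2 * w - w^3) \<le> M"
  proof (rule cubic_form_bound_rescaled[OF _ 1])
    fix x y :: real
    assume "x^2 + 3 * y^2 = 1"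
    then have "x^2 + (sqrt 3 * y)^2 = 1"
      by (simp add: power_mult_distrib)
    from f[OF this]
    have "a * x^3 + 3 * b * x^2 * (sqrt 3 * y) + 3 * c * x * (3 * y^2) + d * (3 * sqrt 3 * y^3) \<le> M"
      by (simp add: power2_eq_square power3_eq_cube algebra_simps)
    then show "a * x^3 + 3 * (sqrt 3 * b) * x^2 * y + 9 * c * x * y^2 + 3 * (sqrt 3 * d) * y^3 \<le> M"
      by (simp add: mult_ac)
  qed
  then show ?thesis
    unfolding u v by (simp add: mult_ac)
qed

section \<open>Symmetry of the second derivative\<close>

text \<open>
  The mean value theorem, applied to the increment of \<open>f\<close> in direction \<open>v\<close> as a function of the
  distance moved in direction \<open>u\<close>, and differentiability of the gradient \<open>g\<close> at the single point \<open>x\<close>.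
\<close>

lemma second_difference:
  fixes f :: "'a::real_inner \<Rightarrow> real"
  assumes S: "open S" "x \<in> S" and f: "\<And>y. y \<in> S \<Longrightarrow> (f has_derivative (\<lambda>h. g y \<bullet> h)) (at y)"
    and g: "(g has_derivative A) (at x)" and e: "e > 0"
  shows "\<exists>d>0. \<forall>t. 0 < t \<and> t < d \<longrightarrow>
    \<bar>f (x + t *\<^sub>R u + t *\<^sub>R v) - f (x + t *\<^sub>R u) - f (x + t *\<^sub>R v) + f x - t^2 * (A v \<bullet> u)\<bar> \<le> e * t^2"
proof -
  interpret A: bounded_linear A using g by (rule has_derivative_bounded_linear)
  define K where "K = norm u + norm v + 1"
  have K: "K > 0" "norm u \<le> K" by (auto simp: K_def add_nonneg_pos)
  define e' where "e' = e / (2 * K * K)"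
  have e': "e' > 0" using e K by (simp add: e'_def)
  obtain d0 where d0: "d0 > 0" "\<And>y. norm (y - x) < d0 \<Longrightarrow> norm (g y - g x - A (y - x)) \<le> e' * norm (y - x)"
    using g e' unfolding has_derivative_at_alt by blast
  obtain r where r: "r > 0" "ball x r \<subseteq> S"
    using S open_contains_ball by blast
  define d where "d = min d0 r / K"
  have d: "d > 0" using d0 r K by (simp add: d_def)
  have main: "\<bar>f (x + t *\<^sub>R u + t *\<^sub>R v) - f (x + t *\<^sub>R u) - f (x + t *\<^sub>R v) + f x - t^2 * (A v \<bullet> u)\<bar> \<le> e * t^2"
    if t: "0 < t" "t < d" for t
  proof -
    have tK: "t * K < min d0 r"
      using t K by (simp add: d_def pos_less_divide_eq)
    have near: "norm (s *\<^sub>R u + q *\<^sub>R v) \<le> t * K" if "0 \<le> s" "s \<le> t" "0 \<le> q" "q \<le> t" for s q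
    proof -
      have "norm (s *\<^sub>R u + q *\<^sub>R v) \<le> s * norm u + q * norm v"
        using that by (metis abs_of_nonneg norm_scaleR norm_triangle_ineq)
      also have "\<dots> \<le> t * norm u + t * norm v"
        using that by (intro add_mono mult_right_mono) auto
      also have "\<dots> \<le> t * K" using t by (simp add: K_def algebra_simps)
      finally show ?thesis .
    qed
    have inS: "x + s *\<^sub>R u + q *\<^sub>R v \<in> S" if "0 \<le> s" "s \<le> t" "0 \<le> q" "q \<le> t" for s q
    proof -
      have "norm (s *\<^sub>R u + q *\<^sub>R v) < r" using near[OF that] tK by linarith
      moreover have "dist x (x + (s *\<^sub>R u + q *\<^sub>R v)) = norm (s *\<^sub>R u + q *\<^sub>R v)"
        unfolding dist_norm norm_minus_commute[of x] by simp
      ultimately have "x + s *\<^sub>R u + q *\<^sub>R v \<in> ball x r"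
        by (simp add: add.assoc)
      then show ?thesis using r by blast
    qed
    have gerr: "norm (g (x + s *\<^sub>R u + q *\<^sub>R v) - g x - A (s *\<^sub>R u + q *\<^sub>R v)) \<le> e' * (t * K)"
      if "0 \<le> s" "s \<le> t" "0 \<le> q" "q \<le> t" for s q
    proof -
      have "norm (x + s *\<^sub>R u + q *\<^sub>R v - x) < d0" using near[OF that] tK by (simp add: add.assoc)
      from d0(2)[OF this] have "norm (g (x + s *\<^sub>R u + q *\<^sub>R v) - g x - A (s *\<^sub>R u + q *\<^sub>R v))
          \<le> e' * norm (s *\<^sub>R u + q *\<^sub>R v)" by (simp add: add.assoc)
      also have "\<dots> \<le> e' * (t * K)" using near[OF that] e' by simp
      finally show ?thesis .
    qed
    define \<phi> where "\<phi> s = f (x + s *\<^sub>R u + t *\<^sub>R v) - f (x + s *\<^sub>R u)" for s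
    have line: "((\<lambda>s. f (x + s *\<^sub>R u + q *\<^sub>R v)) has_real_derivative g (x + s *\<^sub>R u + q *\<^sub>R v) \<bullet> u) (at s)"
      if "0 \<le> s" "s \<le> t" "0 \<le> q" "q \<le> t" for s q
    proof -
      have 1: "((\<lambda>s. x + s *\<^sub>R u + q *\<^sub>R v) has_derivative (\<lambda>h. h *\<^sub>R u)) (at s)"
        by (auto intro!: derivative_eq_intros)
      from has_derivative_compose[OF 1 f[OF inS[OF that]]]
      show ?thesis unfolding has_field_derivative_def
        by (rule has_derivative_eq_rhs) auto
    qed
    have "\<exists>z>0. z < t \<and> \<phi> t - \<phi> 0 = (t - 0) * (g (x + z *\<^sub>R u + t *\<^sub>R v) \<bullet> u - g (x + z *\<^sub>R u) \<bullet> u)"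
    proof (rule MVT2[OF t(1)])
      fix s assume s: "0 \<le> s" "s \<le> t"
      show "(\<phi> has_real_derivative g (x + s *\<^sub>R u + t *\<^sub>R v) \<bullet> u - g (x + s *\<^sub>R u) \<bullet> u) (at s)"
        unfolding \<phi>_def using line[of s t] line[of s 0] s t by (intro DERIV_diff) auto
    qed
    then obtain z where z: "0 < z" "z < t"
      and mv: "\<phi> t - \<phi> 0 = t * ((g (x + z *\<^sub>R u + t *\<^sub>R v) - g (x + z *\<^sub>R u)) \<bullet> u)"
      by (auto simp: inner_diff_left)
    define E where "E = (g (x + z *\<^sub>R u + t *\<^sub>R v) - g x - A (z *\<^sub>R u + t *\<^sub>R v))
        - (g (x + z *\<^sub>R u) - g x - A (z *\<^sub>R u))"
    have "norm E \<le> e' * (t * K) + e' * (t * K)"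
      unfolding E_def using gerr[of z t] gerr[of z 0] z t
      by (intro order_trans[OF norm_triangle_ineq4 add_mono]) auto
    then have E: "norm E \<le> 2 * e' * K * t" by (simp add: algebra_simps)
    have "g (x + z *\<^sub>R u + t *\<^sub>R v) - g (x + z *\<^sub>R u) = t *\<^sub>R A v + E"
      unfolding E_def by (simp add: A.add A.scaleR)
    then have "\<phi> t - \<phi> 0 - t^2 * (A v \<bullet> u) = t * (E \<bullet> u)"
      unfolding mv by (simp add: inner_add_left power2_eq_square algebra_simps)
    then have "\<bar>\<phi> t - \<phi> 0 - t^2 * (A v \<bullet> u)\<bar> = t * \<bar>E \<bullet> u\<bar>"
      using t by (simp add: abs_mult)
    also have "\<dots> \<le> t * ((2 * e' * K * t) * K)"
      using t E K e' by (intro mult_left_mono order_trans[OF Cauchy_Schwarz_ineq2] mult_mono) auto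
    also have "\<dots> = (2 * K * K * e') * t^2"
      by (simp add: power2_eq_square)
    also have "2 * K * K * e' = e"
      using K by (simp add: e'_def)
    finally have fin: "\<bar>\<phi> t - \<phi> 0 - t^2 * (A v \<bullet> u)\<bar> \<le> e * t^2" .
    have eq: "f (x + t *\<^sub>R u + t *\<^sub>R v) - f (x + t *\<^sub>R u) - f (x + t *\<^sub>R v) + f x = \<phi> t - \<phi> 0"
      unfolding \<phi>_def by simp
    show ?thesis using fin unfolding eq .
  qed
  show ?thesis
    by (rule exI[of _ d], intro conjI allI impI, rule d, elim conjE, rule main)
qed

text \<open>
  The second difference is symmetric in the two directions, and so is its limit.
\<close>

lemma second_derivative_symmetric:
  fixes f :: "'a::real_inner \<Rightarrow> real"
  assumes S: "open S" "x \<in> S" and f: "\<And>y. y \<in> S \<Longrightarrow> (f has_derivative (\<lambda>h. g y \<bullet> h)) (at y)"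
    and g: "(g has_derivative A) (at x)"
  shows "A u \<bullet> v = A v \<bullet> u"
proof (rule ccontr)
  assume ne: "A u \<bullet> v \<noteq> A v \<bullet> u"
  define e where "e = \<bar>A u \<bullet> v - A v \<bullet> u\<bar> / 3"
  have e: "e > 0" using ne by (simp add: e_def)
  obtain d1 where d1: "d1 > 0" "\<And>t. 0 < t \<Longrightarrow> t < d1 \<Longrightarrow>
    \<bar>f (x + t *\<^sub>R u + t *\<^sub>R v) - f (x + t *\<^sub>R u) - f (x + t *\<^sub>R v) + f x - t^2 * (A v \<bullet> u)\<bar> \<le> e * t^2"
    using second_difference[OF S f g e, of u v] by blast
  obtain d2 where d2: "d2 > 0" "\<And>t. 0 < t \<Longrightarrow> t < d2 \<Longrightarrow>
    \<bar>f (x + t *\<^sub>R v + t *\<^sub>R u) - f (x + t *\<^sub>R v) - f (x + t *\<^sub>R u) + f x - t^2 * (A u \<bullet> v)\<bar> \<le> e * t^2"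
    using second_difference[OF S f g e, of v u] by blast
  define t where "t = min d1 d2 / 2"
  have t: "0 < t" "t < d1" "t < d2" using d1 d2 by (auto simp: t_def)
  have sw: "x + t *\<^sub>R v + t *\<^sub>R u = x + t *\<^sub>R u + t *\<^sub>R v" by simp
  have "\<bar>t^2 * (A u \<bullet> v) - t^2 * (A v \<bullet> u)\<bar> \<le> 2 * (e * t^2)"
    using d1(2)[OF t(1,2)] d2(2)[OF t(1,3)] unfolding sw by linarith
  moreover have "\<bar>t^2 * (A u \<bullet> v) - t^2 * (A v \<bullet> u)\<bar> = t^2 * \<bar>A u \<bullet> v - A v \<bullet> u\<bar>"
    by (simp add: abs_mult flip: right_diff_distrib)
  ultimately have "t^2 * \<bar>A u \<bullet> v - A v \<bullet> u\<bar> \<le> t^2 * (2 * e)"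
    by (simp add: mult_ac)
  then have "\<bar>A u \<bullet> v - A v \<bullet> u\<bar> \<le> 2 * e" using t by simp
  then show False using e by (simp add: e_def)
qed

section \<open>Differential inequalities along a path\<close>

text \<open>
  For \<open>m\<close> the squared speed of a curve, \<open>\<bar>m'\<bar> \<le> 2 m\<^sup>3\<^sup>/\<^sup>2\<close> says that the reciprocal of the speed has
  slope between \<open>-1\<close> and \<open>1\<close>.
\<close>

lemma speed_bound_along_path:
  fixes m \<phi> :: "real \<Rightarrow> real"
  assumes m: "\<And>\<tau>. 0 \<le> \<tau> \<Longrightarrow> \<tau> \<le> 1 \<Longrightarrow> (m has_real_derivative m' \<tau>) (at \<tau>)"
    and m_pos: "\<And>\<tau>. 0 \<le> \<tau> \<Longrightarrow> \<tau> \<le> 1 \<Longrightarrow> m \<tau> > 0"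
    and m': "\<And>\<tau>. 0 \<le> \<tau> \<Longrightarrow> \<tau> \<le> 1 \<Longrightarrow> \<bar>m' \<tau>\<bar> \<le> 2 * m \<tau> * sqrt (m \<tau>)"
    and \<rho>: "\<rho> = sqrt (m 0)" "\<rho> < 1" and \<tau>: "0 \<le> \<tau>" "\<tau> \<le> 1"
  shows "sqrt (m \<tau>) \<le> \<rho> / (1 - \<tau> * \<rho>)"
proof -
  have \<rho>0: "\<rho> > 0" using \<rho> m_pos[of 0] by simp
  have "1 / sqrt (m 0) + 0 \<le> 1 / sqrt (m \<tau>) + \<tau>"
  proof (rule DERIV_nonneg_imp_nondecreasing[OF \<tau>(1)])
    fix s assume s: "0 \<le> s" "s \<le> \<tau>"
    then have p: "m s > 0" using m_pos \<tau> by auto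
    have "((\<lambda>\<tau>. 1 / sqrt (m \<tau>) + \<tau>) has_real_derivative 1 - m' s / (2 * m s * sqrt (m s))) (at s)"
      using s \<tau> p by (auto intro!: derivative_eq_intros m simp: field_simps)
    moreover have "0 \<le> 1 - m' s / (2 * m s * sqrt (m s))"
      using m'[of s] s \<tau> p by (simp add: pos_divide_le_eq)
    ultimately show "\<exists>y. ((\<lambda>\<tau>. 1 / sqrt (m \<tau>) + \<tau>) has_real_derivative y) (at s) \<and> 0 \<le> y" by blast
  qed
  then have "1 / \<rho> - \<tau> \<le> 1 / sqrt (m \<tau>)" using \<rho> by simp
  moreover have "\<tau> * \<rho> < 1" using \<tau> \<rho> \<rho>0 by (metis less_le_trans mult.commute mult_left_le not_le less_imp_le)
  then have "(1 - \<tau> * \<rho>) / \<rho> = 1 / \<rho> - \<tau>" "1 - \<tau> * \<rho> > 0" using \<rho>0 by (auto simp: field_simps)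
  moreover have "sqrt (m \<tau>) > 0" using m_pos[OF \<tau>] by simp
  ultimately show ?thesis using \<rho>0 by (simp add: field_simps)
qed

text \<open>
  The bound on \<open>\<phi>'\<close> makes \<open>(1 - \<tau> \<rho>)\<^sup>2 \<phi>\<close> nonincreasing and \<open>\<phi> / (1 - \<tau> \<rho>)\<^sup>2\<close> nondecreasing.
\<close>

lemma gronwall_along_path:
  fixes \<phi> :: "real \<Rightarrow> real"
  assumes \<phi>: "\<And>\<tau>. 0 \<le> \<tau> \<Longrightarrow> \<tau> \<le> 1 \<Longrightarrow> (\<phi> has_real_derivative \<phi>' \<tau>) (at \<tau>)"
    and \<phi>': "\<And>\<tau>. 0 \<le> \<tau> \<Longrightarrow> \<tau> \<le> 1 \<Longrightarrow> \<bar>\<phi>' \<tau>\<bar> \<le> 2 * \<rho> / (1 - \<tau> * \<rho>) * \<phi> \<tau>"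
    and \<rho>: "0 \<le> \<rho>" "\<rho> < 1" and \<tau>: "0 \<le> \<tau>" "\<tau> \<le> 1"
  shows "(1 - \<tau> * \<rho>)^2 * \<phi> \<tau> \<le> \<phi> 0" "(1 - \<tau> * \<rho>)^2 * \<phi> 0 \<le> \<phi> \<tau>"
proof -
  have c: "1 - s * \<rho> > 0" if "0 \<le> s" "s \<le> 1" for s
    using that \<rho> by (metis diff_gt_0_iff_gt le_less_trans mult_left_le_one_le)
  have "(1 - \<tau> * \<rho>)^2 * \<phi> \<tau> \<le> (1 - 0 * \<rho>)^2 * \<phi> 0"
  proof (rule DERIV_nonpos_imp_nonincreasing[OF \<tau>(1)])
    fix s assume s: "0 \<le> s" "s \<le> \<tau>"
    have "((\<lambda>s. (1 - s * \<rho>)^2 * \<phi> s) has_real_derivative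
        (1 - s * \<rho>)^2 * \<phi>' s - 2 * \<rho> * (1 - s * \<rho>) * \<phi> s) (at s)"
      using s \<tau> by (auto intro!: derivative_eq_intros \<phi>)
    moreover have "(1 - s * \<rho>)^2 * \<phi>' s \<le> (1 - s * \<rho>)^2 * (2 * \<rho> / (1 - s * \<rho>) * \<phi> s)"
      using \<phi>'[of s] s \<tau> by (intro mult_left_mono) auto
    then have "(1 - s * \<rho>)^2 * \<phi>' s - 2 * \<rho> * (1 - s * \<rho>) * \<phi> s \<le> 0"
      using c[of s] s \<tau> by (simp add: power2_eq_square)
    ultimately show "\<exists>y. ((\<lambda>s. (1 - s * \<rho>)^2 * \<phi> s) has_real_derivative y) (at s) \<and> y \<le> 0" by blast
  qed
  then show "(1 - \<tau> * \<rho>)^2 * \<phi> \<tau> \<le> \<phi> 0" by simp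
  have "\<phi> 0 / (1 - 0 * \<rho>)^2 \<le> \<phi> \<tau> / (1 - \<tau> * \<rho>)^2"
  proof (rule DERIV_nonneg_imp_nondecreasing[OF \<tau>(1)])
    fix s assume s: "0 \<le> s" "s \<le> \<tau>"
    have cs: "1 - s * \<rho> > 0" using c s \<tau> by simp
    have simplify: "(a * k^2 - b * (2 * k * - \<rho>)) / (k^2 * k^2) = (a + 2 * \<rho> / k * b) / k^2"
      if "k > 0" for a b k :: real
      using that by (simp add: field_simps power2_eq_square)
    have "((\<lambda>s. (1 - s * \<rho>)^2) has_real_derivative 2 * (1 - s * \<rho>) * - \<rho>) (at s)"
      by (auto intro!: derivative_eq_intros)
    from DERIV_divide[OF \<phi> this]
    have "((\<lambda>s. \<phi> s / (1 - s * \<rho>)^2) has_real_derivative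
        (\<phi>' s * (1 - s * \<rho>)^2 - \<phi> s * (2 * (1 - s * \<rho>) * - \<rho>)) / ((1 - s * \<rho>)^2 * (1 - s * \<rho>)^2)) (at s)"
      using s \<tau> cs by simp
    then have "((\<lambda>s. \<phi> s / (1 - s * \<rho>)^2) has_real_derivative
        (\<phi>' s + 2 * \<rho> / (1 - s * \<rho>) * \<phi> s) / (1 - s * \<rho>)^2) (at s)"
      unfolding simplify[OF cs] .
    moreover have "0 \<le> (\<phi>' s + 2 * \<rho> / (1 - s * \<rho>) * \<phi> s) / (1 - s * \<rho>)^2"
      using \<phi>'[of s] s \<tau> by (intro divide_nonneg_nonneg) auto
    ultimately show "\<exists>y. ((\<lambda>s. \<phi> s / (1 - s * \<rho>)^2) has_real_derivative y) (at s) \<and> 0 \<le> y" by blast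
  qed
  then show "(1 - \<tau> * \<rho>)^2 * \<phi> 0 \<le> \<phi> \<tau>"
    using c[OF \<tau>] by (simp add: pos_le_divide_eq mult.commute)
qed

section \<open>Self-concordant barriers\<close>

lemma powr_three_halves: "0 \<le> q \<Longrightarrow> q powr (3/2) = q * sqrt q" for q :: real
proof (cases "q = 0")
  case False
  assume "0 \<le> q"
  have "q powr (1 + 1/2) = q powr 1 * q powr (1/2)"
    by (rule powr_add)
  then show ?thesis using \<open>0 \<le> q\<close> by (simp add: powr_half_sqrt)
qed simp

text \<open>
  \<open>G\<close>, \<open>H x\<close> and \<open>T x w\<close> are the gradient, the Hessian and the derivative of the Hessian in
  direction \<open>w\<close>, the last two as operators.  The derivative of the Hessian is asked for one argument \<open>k\<close>
  at a time, which keeps the passage to a sum of two barriers elementary.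
\<close>

locale self_concordant =
  fixes D :: "'a::euclidean_space set" and F :: "'a \<Rightarrow> real" and G :: "'a \<Rightarrow> 'a"
    and H :: "'a \<Rightarrow> 'a \<Rightarrow> 'a" and T :: "'a \<Rightarrow> 'a \<Rightarrow> 'a \<Rightarrow> 'a"
  assumes open_D: "open D" and convex_D: "convex D" and bounded_D: "bounded D" and D_ne: "D \<noteq> {}"
    and F_deriv: "x \<in> D \<Longrightarrow> (F has_derivative (\<lambda>h. G x \<bullet> h)) (at x)"
    and G_deriv: "x \<in> D \<Longrightarrow> (G has_derivative H x) (at x)"
    and H_deriv: "x \<in> D \<Longrightarrow> ((\<lambda>x. H x k) has_derivative (\<lambda>w. T x w k)) (at x)"
    and convex_F: "convex_on D F"
    and third_bound: "x \<in> D \<Longrightarrow> \<bar>T x h h \<bullet> h\<bar> \<le> 2 * (h \<bullet> H x h) powr (3/2)"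
    and barrier: "z \<in> frontier D \<Longrightarrow> filterlim F at_top (at z within D)"
begin

lemma linear_H: "x \<in> D \<Longrightarrow> linear (H x)"
  using G_deriv has_derivative_linear by blast

lemmas H_simps = linear_add[OF linear_H] linear_diff[OF linear_H] linear_scale[OF linear_H]
  linear_neg[OF linear_H] linear_0[OF linear_H]

lemma H_sym: "x \<in> D \<Longrightarrow> u \<bullet> H x v = v \<bullet> H x u"
  using second_derivative_symmetric[OF open_D _ F_deriv G_deriv, of x u v] by (simp add: inner_commute)

lemma linear_T1: "x \<in> D \<Longrightarrow> linear (\<lambda>w. T x w k)"
  using H_deriv has_derivative_linear by blast

lemma linear_T2:
  assumes "x \<in> D"
  shows "linear (T x w)"
proof (rule linearI)
  fix a b
  have "((\<lambda>y. H y (a + b)) has_derivative (\<lambda>w. T x w a + T x w b)) (at x)"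
  proof (rule has_derivative_transform_within_open[OF _ open_D assms])
    show "((\<lambda>y. H y a + H y b) has_derivative (\<lambda>w. T x w a + T x w b)) (at x)"
      by (intro has_derivative_add H_deriv assms)
  qed (simp add: H_simps)
  then show "T x w (a + b) = T x w a + T x w b"
    using H_deriv[OF assms, of "a + b"] has_derivative_unique by metis
next
  fix c a
  have "((\<lambda>y. H y (c *\<^sub>R a)) has_derivative (\<lambda>w. c *\<^sub>R T x w a)) (at x)"
  proof (rule has_derivative_transform_within_open[OF _ open_D assms])
    show "((\<lambda>y. c *\<^sub>R H y a) has_derivative (\<lambda>w. c *\<^sub>R T x w a)) (at x)"
      by (intro has_derivative_scaleR_right H_deriv assms)
  qed (simp add: H_simps)
  then show "T x w (c *\<^sub>R a) = c *\<^sub>R T x w a"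
    using H_deriv[OF assms, of "c *\<^sub>R a"] has_derivative_unique by metis
qed

lemmas T_simps = linear_add[OF linear_T1] linear_scale[OF linear_T1] linear_neg[OF linear_T1]
  linear_add[OF linear_T2] linear_scale[OF linear_T2] linear_neg[OF linear_T2]
  linear_0[OF linear_T1] linear_0[OF linear_T2]

lemma T_outer:
  assumes "x \<in> D"
  shows "T x w h \<bullet> k = T x w k \<bullet> h"
proof -
  have 1: "((\<lambda>y. H y h \<bullet> k) has_derivative (\<lambda>w. T x w h \<bullet> k)) (at x)"
    by (intro has_derivative_inner_left H_deriv assms)
  have 2: "((\<lambda>y. H y k \<bullet> h) has_derivative (\<lambda>w. T x w k \<bullet> h)) (at x)"
    by (intro has_derivative_inner_left H_deriv assms)
  have "((\<lambda>y. H y h \<bullet> k) has_derivative (\<lambda>w. T x w k \<bullet> h)) (at x)"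
    by (rule has_derivative_transform_within_open[OF 2 open_D assms])
      (metis H_sym inner_commute)
  then show ?thesis
    using 1 has_derivative_unique by metis
qed

text \<open>
  \<open>H x k\<close> is the gradient of \<open>\<lambda>y. G y \<bullet> k\<close>, whose second derivative is symmetric.  Together with
  \<open>T_outer\<close> this makes \<open>T x u v \<bullet> w\<close> a symmetric trilinear form.
\<close>

lemma T_inner:
  assumes "x \<in> D"
  shows "T x u v = T x v u"
proof (rule vector_eq_rdot[THEN iffD1], rule allI)
  fix k
  have "T x u k \<bullet> v = T x v k \<bullet> u"
  proof (rule second_derivative_symmetric[OF open_D assms _ H_deriv[OF assms]])
    fix y assume y: "y \<in> D"
    have "((\<lambda>y. G y \<bullet> k) has_derivative (\<lambda>w. H y w \<bullet> k)) (at y)"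
      by (intro has_derivative_inner_left G_deriv y)
    then show "((\<lambda>y. G y \<bullet> k) has_derivative (\<lambda>w. H y k \<bullet> w)) (at y)"
      using H_sym[OF y] by (simp add: inner_commute)
  qed
  then show "T x u v \<bullet> k = T x v u \<bullet> k"
    using T_outer[OF assms] by metis
qed

lemma tangent_below:
  assumes "x \<in> D" "y \<in> D"
  shows "F x + G x \<bullet> (y - x) \<le> F y"
proof -
  have "((\<lambda>t. F (x + t *\<^sub>R (y - x))) has_derivative (\<lambda>h. G x \<bullet> (h *\<^sub>R (y - x)))) (at 0)"
    by (rule has_derivative_compose[of "\<lambda>t. x + t *\<^sub>R (y - x)" "\<lambda>h. h *\<^sub>R (y - x)"])
      (auto intro!: derivative_eq_intros F_deriv assms)
  then have "((\<lambda>t. F (x + t *\<^sub>R (y - x))) has_real_derivative G x \<bullet> (y - x)) (at 0)"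
    unfolding has_field_derivative_def by (rule has_derivative_eq_rhs) (auto simp: fun_eq_iff)
  then have "((\<lambda>t. (F (x + t *\<^sub>R (y - x)) - F x) / t) \<longlongrightarrow> G x \<bullet> (y - x)) (at 0)"
    unfolding DERIV_def by simp
  then have lim: "((\<lambda>t. (F (x + t *\<^sub>R (y - x)) - F x) / t) \<longlongrightarrow> G x \<bullet> (y - x)) (at_right 0)"
    by (rule filterlim_mono) (auto simp: at_within_le_at)
  have "\<forall>\<^sub>F t in at_right 0. (F (x + t *\<^sub>R (y - x)) - F x) / t \<le> F y - F x"
  proof (rule eventually_at_rightI[of 0 1])
    fix t :: real assume t: "t \<in> {0<..<1}"
    have "F ((1 - t) *\<^sub>R x + t *\<^sub>R y) \<le> (1 - t) * F x + t * F y"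
      using convex_onD[OF convex_F] t assms by auto
    then have "F (x + t *\<^sub>R (y - x)) - F x \<le> t * (F y - F x)"
      by (simp add: algebra_simps)
    then show "(F (x + t *\<^sub>R (y - x)) - F x) / t \<le> F y - F x"
      using t by (simp add: pos_divide_le_eq mult.commute)
  qed simp
  then have "G x \<bullet> (y - x) \<le> F y - F x"
    by (rule tendsto_upperbound[OF lim]) simp
  then show ?thesis by simp
qed

lemma G_monotone:
  assumes "x \<in> D" "y \<in> D"
  shows "0 \<le> (G y - G x) \<bullet> (y - x)"
  using tangent_below[OF assms] tangent_below[OF assms(2,1)]
  by (simp add: inner_diff_left inner_diff_right)

lemma line_derivs:
  assumes "x + \<tau> *\<^sub>R w \<in> D"
  shows "((\<lambda>\<tau>. F (x + \<tau> *\<^sub>R w)) has_real_derivative G (x + \<tau> *\<^sub>R w) \<bullet> w) (at \<tau>)"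
    and "((\<lambda>\<tau>. G (x + \<tau> *\<^sub>R w)) has_vector_derivative H (x + \<tau> *\<^sub>R w) w) (at \<tau>)"
    and "((\<lambda>\<tau>. G (x + \<tau> *\<^sub>R w) \<bullet> k) has_real_derivative k \<bullet> H (x + \<tau> *\<^sub>R w) w) (at \<tau>)"
proof -
  have l: "((\<lambda>\<tau>. x + \<tau> *\<^sub>R w) has_derivative (\<lambda>h. h *\<^sub>R w)) (at \<tau>)"
    by (auto intro!: derivative_eq_intros)
  show "((\<lambda>\<tau>. F (x + \<tau> *\<^sub>R w)) has_real_derivative G (x + \<tau> *\<^sub>R w) \<bullet> w) (at \<tau>)"
    using has_derivative_compose[OF l F_deriv[OF assms]]
    unfolding has_field_derivative_def by (rule has_derivative_eq_rhs) (auto simp: fun_eq_iff)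
  show 2: "((\<lambda>\<tau>. G (x + \<tau> *\<^sub>R w)) has_vector_derivative H (x + \<tau> *\<^sub>R w) w) (at \<tau>)"
    using has_derivative_compose[OF l G_deriv[OF assms]]
    unfolding has_vector_derivative_def
    by (rule has_derivative_eq_rhs) (auto simp: fun_eq_iff H_simps[OF assms])
  show "((\<lambda>\<tau>. G (x + \<tau> *\<^sub>R w) \<bullet> k) has_real_derivative k \<bullet> H (x + \<tau> *\<^sub>R w) w) (at \<tau>)"
    using has_derivative_inner_left[OF 2[unfolded has_vector_derivative_def], of k]
    unfolding has_field_derivative_def
    by (rule has_derivative_eq_rhs) (auto simp: fun_eq_iff inner_commute)
qed

lemma quad_along_path:
  assumes X: "(X has_vector_derivative V) (at \<tau>)" and D: "X \<tau> \<in> D"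
  shows "((\<lambda>\<tau>. k \<bullet> H (X \<tau>) h) has_real_derivative k \<bullet> T (X \<tau>) V h) (at \<tau>)"
  using has_derivative_inner_right[OF has_derivative_compose[OF X[unfolded has_vector_derivative_def] H_deriv[OF D]], of k h]
  unfolding has_field_derivative_def
  by (rule has_derivative_eq_rhs) (auto simp: fun_eq_iff T_simps[OF D])

lemma psd:
  assumes x: "x \<in> D"
  shows "0 \<le> h \<bullet> H x h"
proof -
  obtain r where r: "r > 0" "ball x r \<subseteq> D"
    using open_D x open_contains_ball by blast
  have lim: "((\<lambda>t. (G (x + t *\<^sub>R h) \<bullet> h - G x \<bullet> h) / t) \<longlongrightarrow> h \<bullet> H x h) (at 0)"
    using line_derivs(3)[of x 0 h h] x unfolding DERIV_def by simp
  have "\<forall>\<^sub>F t in at 0. 0 \<le> (G (x + t *\<^sub>R h) \<bullet> h - G x \<bullet> h) / t"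
  proof -
    have "((\<lambda>t. x + t *\<^sub>R h) \<longlongrightarrow> x + 0 *\<^sub>R h) (at 0)"
      by (intro tendsto_intros)
    then have "\<forall>\<^sub>F t in at 0. x + t *\<^sub>R h \<in> D"
      using open_D x by (intro topological_tendstoD) auto
    then show ?thesis
    proof (rule eventually_mono)
      fix t assume t: "x + t *\<^sub>R h \<in> D"
      have "0 \<le> t * (G (x + t *\<^sub>R h) \<bullet> h - G x \<bullet> h)"
        using G_monotone[OF x t] by (simp add: inner_diff_left algebra_simps)
      then show "0 \<le> (G (x + t *\<^sub>R h) \<bullet> h - G x \<bullet> h) / t"
        by (simp add: zero_le_mult_iff zero_le_divide_iff) linarith
    qed
  qed
  then show ?thesis
    by (rule tendsto_lowerbound[OF lim]) simp
qed

definition N :: "'a \<Rightarrow> 'a \<Rightarrow> real" where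
  "N x h = sqrt (h \<bullet> H x h)"

lemma N_sq: "x \<in> D \<Longrightarrow> (N x h)^2 = h \<bullet> H x h"
  by (simp add: N_def psd)

lemma N_nonneg [simp]: "x \<in> D \<Longrightarrow> 0 \<le> N x h"
  by (simp add: N_def psd)

lemma third_bound_N: "x \<in> D \<Longrightarrow> \<bar>T x h h \<bullet> h\<bar> \<le> 2 * (h \<bullet> H x h) * N x h"
proof -
  assume x: "x \<in> D"
  from third_bound[OF x, of h] powr_three_halves[OF psd[OF x, of h]] show ?thesis
    by (simp add: N_def)
qed

text \<open>
  If \<open>h\<close> is in the kernel of \<open>H x\<close>, self-concordance propagates this along the
  whole ray from \<open>x\<close> in direction \<open>h\<close>: the quadratic form along the ray obeys
  a differential inequality with zero initial value.  So \<open>F\<close> is affine on the ray, which reaches the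
  boundary of the bounded domain, where \<open>F\<close> tends to infinity.
\<close>

lemma nondegenerate:
  assumes x: "x \<in> D" and h: "h \<noteq> 0"
  shows "0 < h \<bullet> H x h"
proof (rule ccontr)
  assume "\<not> 0 < h \<bullet> H x h"
  then have zero: "h \<bullet> H x h = 0" using psd[OF x, of h] by simp
  obtain d where d: "0 < d" "x + d *\<^sub>R h \<in> frontier D"
    and inD: "\<And>e. 0 \<le> e \<Longrightarrow> e < d \<Longrightarrow> x + e *\<^sub>R h \<in> D"
    using ray_to_frontier[OF bounded_D _ h, of x] x open_D by (auto simp: interior_open)
  define \<phi> where "\<phi> \<tau> = h \<bullet> H (x + \<tau> *\<^sub>R h) h" for \<tau>
  have \<phi>d: "(\<phi> has_real_derivative h \<bullet> T (x + \<tau> *\<^sub>R h) h h) (at \<tau>)" if "0 \<le> \<tau>" "\<tau> < d" for \<tau>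
    unfolding \<phi>_def by (rule quad_along_path) (auto intro!: derivative_eq_intros inD that)
  have \<phi>0: "0 \<le> \<phi> \<tau>" if "0 \<le> \<tau>" "\<tau> < d" for \<tau>
    using psd inD that by (simp add: \<phi>_def)
  have \<phi>z: "\<phi> \<tau> = 0" if \<tau>: "0 \<le> \<tau>" "\<tau> < d" for \<tau>
  proof -
    have "continuous_on {0..\<tau>} (\<lambda>\<tau>. sqrt (\<phi> \<tau>))"
      using \<phi>d \<tau> by (intro continuous_intros continuous_at_imp_continuous_on) (force intro: DERIV_isCont)
    then have "bounded ((\<lambda>\<tau>. sqrt (\<phi> \<tau>)) ` {0..\<tau>})"
      by (intro compact_imp_bounded compact_continuous_image) auto
    then obtain M where M0: "\<forall>x\<in>(\<lambda>\<tau>. sqrt (\<phi> \<tau>)) ` {0..\<tau>}. norm x \<le> M"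
      unfolding bounded_iff by blast
    have M: "sqrt (\<phi> s) \<le> M" if "0 \<le> s" "s \<le> \<tau>" for s
      using M0[rule_format, of "sqrt (\<phi> s)"] that by auto
    have "\<phi> \<tau> * exp (- (2 * M * \<tau>)) \<le> \<phi> 0 * exp (- (2 * M * 0))"
    proof (rule DERIV_nonpos_imp_nonincreasing[OF \<tau>(1)])
      fix s assume s: "0 \<le> s" "s \<le> \<tau>"
      let ?T = "h \<bullet> T (x + s *\<^sub>R h) h h"
      have "((\<lambda>s. \<phi> s * exp (- (2 * M * s))) has_real_derivative
          (?T - 2 * M * \<phi> s) * exp (- (2 * M * s))) (at s)"
        using s \<tau> by (auto intro!: derivative_eq_intros \<phi>d simp: algebra_simps)
      moreover have "?T \<le> 2 * M * \<phi> s"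
      proof -
        have "?T \<le> 2 * \<phi> s * sqrt (\<phi> s)"
          using third_bound_N[OF inD[of s], of h] s \<tau> by (simp add: \<phi>_def N_def inner_commute)
        also have "\<dots> \<le> 2 * \<phi> s * M"
          using M[OF s] \<phi>0[of s] s \<tau> by (intro mult_left_mono) auto
        finally show ?thesis by (simp add: mult_ac)
      qed
      then have "(?T - 2 * M * \<phi> s) * exp (- (2 * M * s)) \<le> 0"
        by (simp add: mult_nonpos_nonneg)
      ultimately show "\<exists>y. ((\<lambda>s. \<phi> s * exp (- (2 * M * s))) has_real_derivative y) (at s) \<and> y \<le> 0"
        by blast
    qed
    then have "\<phi> \<tau> * exp (- (2 * M * \<tau>)) \<le> 0"
      using zero by (simp add: \<phi>_def)
    then show ?thesis using \<phi>0[OF \<tau>] by (simp add: mult_le_0_iff)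
  qed
  \<comment> \<open>The slope of \<open>F\<close> on the ray is constant, so \<open>F\<close> stays bounded on the segment.\<close>
  have G_const: "G (x + \<tau> *\<^sub>R h) \<bullet> h = G x \<bullet> h" if \<tau>: "0 \<le> \<tau>" "\<tau> < d" for \<tau>
  proof (cases "\<tau> = 0")
    case False
    then have "\<exists>z>0. z < \<tau> \<and> G (x + \<tau> *\<^sub>R h) \<bullet> h - G (x + 0 *\<^sub>R h) \<bullet> h = (\<tau> - 0) * \<phi> z"
      using \<tau> unfolding \<phi>_def by (intro MVT2[where f = "\<lambda>\<tau>. G (x + \<tau> *\<^sub>R h) \<bullet> h"] line_derivs inD) auto
    then show ?thesis using \<phi>z \<tau> by auto
  qed simp
  have F_affine: "F (x + \<tau> *\<^sub>R h) \<le> F x + d * \<bar>G x \<bullet> h\<bar>" if \<tau>: "0 < \<tau>" "\<tau> < d" for \<tau>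
  proof -
    have "\<exists>z>0. z < \<tau> \<and> F (x + \<tau> *\<^sub>R h) - F (x + 0 *\<^sub>R h) = (\<tau> - 0) * (G (x + z *\<^sub>R h) \<bullet> h)"
      using \<tau> by (intro MVT2[where f = "\<lambda>\<tau>. F (x + \<tau> *\<^sub>R h)"] line_derivs inD) auto
    then have "F (x + \<tau> *\<^sub>R h) - F x = \<tau> * (G x \<bullet> h)"
      using G_const \<tau> by auto
    also have "\<dots> \<le> \<tau> * \<bar>G x \<bullet> h\<bar>" using \<tau> by (intro mult_left_mono) auto
    also have "\<dots> \<le> d * \<bar>G x \<bullet> h\<bar>" using \<tau> by (intro mult_right_mono) auto
    finally show ?thesis by simp
  qed
  have "filterlim (\<lambda>\<tau>. F (x + \<tau> *\<^sub>R h)) at_top (at_left d)"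
  proof (rule filterlim_compose[OF barrier[OF d(2)]])
    show "filterlim (\<lambda>\<tau>. x + \<tau> *\<^sub>R h) (at (x + d *\<^sub>R h) within D) (at_left d)"
      unfolding filterlim_at
    proof
      have "\<forall>\<^sub>F \<tau> in at_left d. \<tau> \<in> {0<..<d}"
        by (auto simp: eventually_at_left[OF d(1)] intro!: exI[of _ 0] d(1))
      then show "\<forall>\<^sub>F \<tau> in at_left d. x + \<tau> *\<^sub>R h \<in> D \<and> x + \<tau> *\<^sub>R h \<noteq> x + d *\<^sub>R h"
        by (rule eventually_mono) (use inD h in auto)
      show "((\<lambda>\<tau>. x + \<tau> *\<^sub>R h) \<longlongrightarrow> x + d *\<^sub>R h) (at_left d)"
        by (intro tendsto_intros)
    qed
  qed
  then have "\<forall>\<^sub>F \<tau> in at_left d. F x + d * \<bar>G x \<bullet> h\<bar> < F (x + \<tau> *\<^sub>R h)"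
    by (simp add: filterlim_at_top_dense)
  moreover have "\<forall>\<^sub>F \<tau> in at_left d. \<tau> \<in> {0<..<d}"
    by (auto simp: eventually_at_left[OF d(1)] intro!: exI[of _ 0] d(1))
  ultimately have "\<forall>\<^sub>F \<tau> in at_left d. False"
    by eventually_elim (use F_affine in force)
  then show False by (simp add: trivial_limit_at_left_real)
qed

lemma N_pos: "x \<in> D \<Longrightarrow> h \<noteq> 0 \<Longrightarrow> 0 < N x h"
  by (simp add: N_def nondegenerate)

lemma N_zero [simp]: "x \<in> D \<Longrightarrow> N x 0 = 0"
  by (simp add: N_def)

lemma N_scale: "x \<in> D \<Longrightarrow> N x (c *\<^sub>R h) = \<bar>c\<bar> * N x h"
  by (simp add: N_def H_simps real_sqrt_mult flip: mult.assoc)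

lemma N_minus: "x \<in> D \<Longrightarrow> N x (- h) = N x h"
  by (simp add: N_def H_simps)

lemma N_minus_commute: "x \<in> D \<Longrightarrow> N x (u - v) = N x (v - u)"
  using N_minus[of x "u - v"] by simp

lemma cauchy_schwarz:
  assumes x: "x \<in> D"
  shows "u \<bullet> H x v \<le> N x u * N x v"
proof (cases "v = 0")
  case False
  let ?a = "v \<bullet> H x v" and ?b = "u \<bullet> H x v"
  have pos: "?a > 0" using nondegenerate[OF x False] .
  have "0 \<le> (?a *\<^sub>R u - ?b *\<^sub>R v) \<bullet> H x (?a *\<^sub>R u - ?b *\<^sub>R v)"
    by (rule psd[OF x])
  also have "\<dots> = ?a * (?a * (u \<bullet> H x u) - ?b^2)"
    using H_sym[OF x, of v u]
    by (simp add: H_simps[OF x] inner_diff_left inner_diff_right power2_eq_square algebra_simps)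
  finally have "?b^2 \<le> (u \<bullet> H x u) * ?a"
    using pos by (simp add: zero_le_mult_iff mult.commute)
  then have "\<bar>?b\<bar> \<le> sqrt ((u \<bullet> H x u) * ?a)"
    by (metis real_sqrt_abs real_sqrt_le_mono)
  then show ?thesis by (simp add: N_def real_sqrt_mult)
qed (simp add: H_simps x)

lemma N_triangle:
  assumes x: "x \<in> D"
  shows "N x (u + v) \<le> N x u + N x v"
proof (rule power2_le_imp_le)
  have "(N x (u + v))^2 = u \<bullet> H x u + 2 * (u \<bullet> H x v) + v \<bullet> H x v"
    unfolding N_sq[OF x] using H_sym[OF x, of v u]
    by (simp add: H_simps[OF x] inner_add_left inner_add_right)
  also have "\<dots> \<le> (N x u)^2 + 2 * (N x u * N x v) + (N x v)^2"
    using cauchy_schwarz[OF x] by (simp add: N_sq[OF x])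
  finally show "(N x (u + v))^2 \<le> (N x u + N x v)^2"
    by (simp add: power2_sum)
qed (use x in simp)

text \<open>
  By homogeneity \<open>h\<close> is a unit vector \<open>e\<close> of the local norm, and \<open>w = a e + v e2\<close> in an
  orthogonal decomposition; \<open>cubic_form_bound\<close> applies to the plane spanned by \<open>e\<close> and \<open>e2\<close>.
\<close>

lemma third_mixed_upper:
  assumes x: "x \<in> D"
  shows "T x w h \<bullet> h \<le> 2 * N x w * (N x h)^2"
proof (cases "h = 0 \<or> w = 0")
  case True
  then show ?thesis using x by (auto simp: T_simps)
next
  case False
  define n where "n = N x h"
  have n: "n > 0" using N_pos x False by (simp add: n_def)
  define e where "e = (1 / n) *\<^sub>R h"
  have h: "h = n *\<^sub>R e" using n by (simp add: e_def)
  have "h \<bullet> H x h = n * n"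
    using N_sq[OF x, of h] by (simp add: n_def power2_eq_square)
  then have e1: "e \<bullet> H x e = 1"
    using n by (simp add: e_def H_simps[OF x])
  define a where "a = e \<bullet> H x w"
  define w' where "w' = w - a *\<^sub>R e"
  define v where "v = N x w'"
  define e2 where "e2 = (1 / v) *\<^sub>R w'"
  have w': "w' = v *\<^sub>R e2"
    using N_pos[OF x, of w'] by (cases "w' = 0") (auto simp: e2_def v_def)
  have w: "w = a *\<^sub>R e + v *\<^sub>R e2"
    using w' by (simp add: w'_def algebra_simps)
  have orth: "e \<bullet> H x e2 = 0"
    by (simp add: e2_def w'_def H_simps[OF x] inner_diff_right e1 a_def)
  have orth': "e2 \<bullet> H x e = 0"
    using orth H_sym[OF x] by simp
  \<comment> \<open>When \<open>w\<close> is parallel to \<open>e\<close>, division by zero gives \<open>e2 = 0\<close>; an inequality covers both cases.\<close>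
  have e2: "e2 \<bullet> H x e2 \<le> 1"
  proof (cases "v = 0")
    case False
    have "v^2 * (e2 \<bullet> H x e2) = (v *\<^sub>R e2) \<bullet> H x (v *\<^sub>R e2)"
      by (simp add: H_simps[OF x] power2_eq_square)
    also have "\<dots> = v^2"
      unfolding w'[symmetric] by (simp add: v_def N_sq[OF x])
    finally have "v^2 * (e2 \<bullet> H x e2) = v^2" .
    then show ?thesis using False by simp
  qed (simp add: e2_def H_simps x)
  have Nw: "(N x w)^2 = a^2 + v^2"
  proof -
    have "w' \<bullet> H x w' = v^2" by (simp add: v_def N_sq[OF x])
    moreover have "(N x w)^2 = (a *\<^sub>R e + w') \<bullet> H x (a *\<^sub>R e + w')"
      by (simp add: w'_def N_sq[OF x])
    moreover have "e \<bullet> H x w' = 0" "w' \<bullet> H x e = 0"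
      using orth orth' by (simp_all add: w' H_simps[OF x])
    ultimately show ?thesis
      by (simp add: H_simps[OF x] inner_add_left inner_add_right e1 power2_eq_square)
  qed
  define W where "W = N x w"
  have W: "W > 0" using N_pos x False by (simp add: W_def)
  have "(T x e e \<bullet> e) * (a / W) + (T x e2 e \<bullet> e) * (v / W) \<le> 2"
  proof (rule cubic_form_bound[where c = "T x e e2 \<bullet> e2" and d = "T x e2 e2 \<bullet> e2"])
    show "(a / W)^2 + (v / W)^2 = 1"
      using W unfolding power_divide add_divide_distrib[symmetric] Nw[symmetric] W_def[symmetric] by simp
    fix r s :: real
    assume rs: "r^2 + s^2 = 1"
    let ?z = "r *\<^sub>R e + s *\<^sub>R e2"
    have "?z \<bullet> H x ?z = r^2 + s^2 * (e2 \<bullet> H x e2)"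
      by (simp add: H_simps[OF x] inner_add_left inner_add_right e1 orth orth' power2_eq_square)
    also have "\<dots> \<le> r^2 + s^2 * 1"
      using e2 by (intro add_left_mono mult_left_mono) auto
    finally have z: "?z \<bullet> H x ?z \<le> 1" using rs by simp
    have "T x ?z ?z \<bullet> ?z \<le> 2 * (?z \<bullet> H x ?z) * N x ?z"
      using third_bound_N[OF x, of ?z] by simp
    also have "\<dots> \<le> 2 * 1 * 1"
      using z psd[OF x, of ?z] by (intro mult_mono) (auto simp: N_def x)
    finally have "T x ?z ?z \<bullet> ?z \<le> 2" by simp
    moreover have "T x ?z ?z \<bullet> ?z = (T x e e \<bullet> e) * r^3 + 3 * (T x e2 e \<bullet> e) * r^2 * s
        + 3 * (T x e e2 \<bullet> e2) * r * s^2 + (T x e2 e2 \<bullet> e2) * s^3"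
      using T_inner[OF x, of e2 e] T_outer[OF x, of e e e2] T_outer[OF x, of e2 e2 e]
        T_outer[OF x, of e e2 e]
      by (simp add: T_simps[OF x] inner_add_left inner_add_right power2_eq_square power3_eq_cube algebra_simps)
    ultimately show "(T x e e \<bullet> e) * r^3 + 3 * (T x e2 e \<bullet> e) * r^2 * s
        + 3 * (T x e e2 \<bullet> e2) * r * s^2 + (T x e2 e2 \<bullet> e2) * s^3 \<le> 2" by simp
  qed
  then have "(T x e e \<bullet> e) * a + (T x e2 e \<bullet> e) * v \<le> 2 * W"
    using W by (simp add: pos_divide_le_eq flip: add_divide_distrib)
  then have "T x w e \<bullet> e \<le> 2 * W"
    by (subst w) (simp add: T_simps[OF x] inner_add_left mult.commute)
  then have "n^2 * (T x w e \<bullet> e) \<le> n^2 * (2 * W)"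
    by (intro mult_left_mono) auto
  then show ?thesis
    unfolding n_def[symmetric] W_def[symmetric]
    by (subst (1 2) h) (simp add: T_simps[OF x] power2_eq_square mult_ac)
qed

lemma third_mixed:
  assumes x: "x \<in> D"
  shows "\<bar>T x w h \<bullet> h\<bar> \<le> 2 * N x w * (N x h)^2"
  using third_mixed_upper[OF x, of w h] third_mixed_upper[OF x, of "- w" h]
  by (simp add: T_simps[OF x] N_minus[OF x] abs_le_iff)

section \<open>Legendre duality\<close>

lemma G_inj:
  assumes "x \<in> D" "y \<in> D" "G x = G y"
  shows "x = y"
proof (rule ccontr)
  assume ne: "x \<noteq> y"
  let ?w = "y - x"
  have inD: "x + \<tau> *\<^sub>R ?w \<in> D" if "0 \<le> \<tau>" "\<tau> \<le> 1" for \<tau>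
  proof -
    have "(1 - \<tau>) *\<^sub>R x + \<tau> *\<^sub>R y \<in> D"
      using convexD_alt[OF convex_D assms(1,2) that] .
    then show ?thesis by (simp add: algebra_simps)
  qed
  have "\<exists>z>0. z < 1 \<and> G (x + 1 *\<^sub>R ?w) \<bullet> ?w - G (x + 0 *\<^sub>R ?w) \<bullet> ?w
      = (1 - 0) * (?w \<bullet> H (x + z *\<^sub>R ?w) ?w)"
    by (intro MVT2[where f = "\<lambda>\<tau>. G (x + \<tau> *\<^sub>R ?w) \<bullet> ?w"] line_derivs inD) auto
  then obtain z where "0 < z" "z < 1" "?w \<bullet> H (x + z *\<^sub>R ?w) ?w = 0"
    using assms(3) by auto
  then show False
    using nondegenerate[OF inD[of z], of ?w] ne by simp
qed

text \<open>
  The sublevel sets of \<open>\<lambda>x. F x - s \<bullet> x\<close> are compact because \<open>F\<close> tends to infinity at the boundary of the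
  bounded domain.
\<close>

lemma minimizer_exists: "\<exists>x\<in>D. \<forall>z\<in>D. F x - s \<bullet> x \<le> F z - s \<bullet> z"
proof -
  define f where "f x = F x - s \<bullet> x" for x
  obtain x0 where x0: "x0 \<in> D" using D_ne by blast
  define S where "S = {x \<in> D. f x \<le> f x0}"
  have contF: "isCont F x" if "x \<in> D" for x
    using F_deriv[OF that] has_derivative_continuous by blast
  have contf: "continuous_on S f"
    unfolding f_def S_def
    by (intro continuous_intros continuous_at_imp_continuous_on) (auto intro: contF)
  have "closed S"
    unfolding closed_sequential_limits
  proof (intro allI impI, elim conjE)
    fix X l assume X: "\<forall>n. X n \<in> S" and lim: "X \<longlonglongrightarrow> l"
    have XD: "X n \<in> D" "f (X n) \<le> f x0" for n
      using X by (auto simp: S_def)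
    have "l \<in> D"
    proof (rule ccontr)
      assume l: "l \<notin> D"
      have "l \<in> closure D"
        using XD lim closure_sequential by blast
      then have "l \<in> frontier D"
        using l open_D by (simp add: frontier_def interior_open)
      moreover have "X n \<noteq> l" for n
        using XD l by metis
      then have "filterlim X (at l within D) sequentially"
        unfolding filterlim_at using lim XD by simp
      ultimately have "filterlim (\<lambda>n. F (X n)) at_top sequentially"
        by (intro filterlim_compose[OF barrier])
      moreover have "(\<lambda>n. - (s \<bullet> X n)) \<longlonglongrightarrow> - (s \<bullet> l)"
        by (intro tendsto_intros lim)
      ultimately have "filterlim (\<lambda>n. - (s \<bullet> X n) + F (X n)) at_top sequentially"
        by (intro filterlim_tendsto_add_at_top)
      then have "\<forall>\<^sub>F n in sequentially. f x0 < - (s \<bullet> X n) + F (X n)"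
        by (simp add: filterlim_at_top_dense)
      then have "\<forall>\<^sub>F n in sequentially. False"
        by (rule eventually_mono) (use XD in \<open>force simp: f_def not_less[symmetric]\<close>)
      then show False by simp
    qed
    moreover have "f l \<le> f x0"
    proof (rule LIMSEQ_le_const2)
      show "(\<lambda>n. f (X n)) \<longlonglongrightarrow> f l"
        unfolding f_def using contF[OF \<open>l \<in> D\<close>] lim
        by (intro tendsto_intros isCont_tendsto_compose[of l F]) auto
    qed (use XD in auto)
    ultimately show "l \<in> S" by (simp add: S_def)
  qed
  moreover have "bounded S"
    using bounded_D by (rule bounded_subset) (auto simp: S_def)
  ultimately have "compact S" by (simp add: compact_eq_bounded_closed)
  moreover have "S \<noteq> {}" using x0 by (auto simp: S_def)
  ultimately obtain x where x: "x \<in> S" "\<And>z. z \<in> S \<Longrightarrow> f x \<le> f z"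
    using continuous_attains_inf[OF _ _ contf] by blast
  have "f x \<le> f z" if "z \<in> D" for z
    using x that by (cases "z \<in> S") (fastforce simp: S_def)+
  then show ?thesis
    using x(1) by (auto simp: f_def S_def)
qed

lemma stationary_of_minimizer:
  assumes x: "x \<in> D" and min: "\<And>z. z \<in> D \<Longrightarrow> F x - s \<bullet> x \<le> F z - s \<bullet> z"
  shows "G x = s"
proof -
  have "((\<lambda>x. F x - s \<bullet> x) has_derivative (\<lambda>h. G x \<bullet> h - s \<bullet> h)) (at x)"
    by (intro derivative_intros F_deriv x)
  then have "(\<lambda>h. G x \<bullet> h - s \<bullet> h) = (\<lambda>h. 0)"
    using differential_zero_maxmin[OF x open_D] min by blast
  then have "G x \<bullet> h = s \<bullet> h" for h
    using fun_cong[of _ _ h] by fastforce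
  then show ?thesis using vector_eq_rdot by blast
qed

lemma G_surj: "\<exists>x\<in>D. G x = s"
  using minimizer_exists[of s] stationary_of_minimizer by meson

lemma minimizer_iff:
  assumes x: "x \<in> D"
  shows "(\<forall>z\<in>D. F x - s \<bullet> x \<le> F z - s \<bullet> z) \<longleftrightarrow> G x = s"
proof
  assume "G x = s"
  moreover obtain x' where "x' \<in> D" "\<forall>z\<in>D. F x' - s \<bullet> x' \<le> F z - s \<bullet> z"
    using minimizer_exists by blast
  ultimately show "\<forall>z\<in>D. F x - s \<bullet> x \<le> F z - s \<bullet> z"
    using stationary_of_minimizer G_inj[OF x] by metis
qed (use stationary_of_minimizer x in blast)

lemma H_surj:
  assumes x: "x \<in> D"
  shows "\<exists>v. H x v = s"
proof -
  have "inj (H x)"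
    unfolding linear_injective_0[OF linear_H[OF x]]
    using nondegenerate[OF x] by (metis inner_zero_right less_irrefl)
  then have "surj (H x)"
    by (rule linear_inj_imp_surj[OF linear_H[OF x]])
  then show ?thesis by (metis surjD)
qed

lemma H_inj:
  assumes x: "x \<in> D" and "H x u = H x v"
  shows "u = v"
proof -
  have "(u - v) \<bullet> H x (u - v) = 0"
    using assms by (simp add: H_simps)
  then show ?thesis
    using nondegenerate[OF x, of "u - v"] by fastforce
qed

definition Hinv :: "'a \<Rightarrow> 'a \<Rightarrow> 'a" where
  "Hinv x s = (SOME v. H x v = s)"

lemma H_Hinv: "x \<in> D \<Longrightarrow> H x (Hinv x s) = s"
  unfolding Hinv_def by (rule someI_ex) (rule H_surj)

text \<open>
  The derivative of the map \<open>(x, v) \<mapsto> (\<nabla>F(x), \<nabla>\<^sup>2F(x) v)\<close>, the tangent map of the gradient.  Its inverse is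
  the tangent map of the inverse of the gradient, so the inverse function theorem for it gives
  two derivatives of that inverse at once.
\<close>

lemma tangent_map_deriv:
  assumes x: "x \<in> D"
  shows "((\<lambda>z. (G (fst z), H (fst z) (snd z))) has_derivative
    (\<lambda>d. (H x (fst d), T x (fst d) v + H x (snd d)))) (at (x, v))"
proof (rule has_derivative_Pair)
  have fst: "(fst has_derivative fst) (at (x, v))"
    by (rule has_derivative_fst[OF has_derivative_ident])
  have snd: "(snd has_derivative snd) (at (x, v))"
    by (rule has_derivative_snd[OF has_derivative_ident])
  show "((\<lambda>z. G (fst z)) has_derivative (\<lambda>d. H x (fst d))) (at (x, v))"
    by (rule has_derivative_compose[OF fst]) (use G_deriv[OF x] in simp)
  \<comment> \<open>Joint differentiability in \<open>(x, v)\<close> follows from that in \<open>x\<close> by an expansion of \<open>v\<close> in coordinates.\<close>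
  have expand: "L u = (\<Sum>i\<in>Basis. (u \<bullet> i) *\<^sub>R L i)" if "linear L" for L :: "'a \<Rightarrow> 'a" and u
    using that by (metis (no_types, lifting) euclidean_representation linear_scale linear_sum sum.cong)
  have "((\<lambda>z. \<Sum>i\<in>Basis. (snd z \<bullet> i) *\<^sub>R H (fst z) i) has_derivative
      (\<lambda>d. \<Sum>i\<in>Basis. (v \<bullet> i) *\<^sub>R T x (fst d) i + (snd d \<bullet> i) *\<^sub>R H x i)) (at (x, v))"
  proof (rule has_derivative_sum)
    fix i
    have "((\<lambda>z. H (fst z) i) has_derivative (\<lambda>d. T x (fst d) i)) (at (x, v))"
      by (rule has_derivative_compose[OF fst]) (use H_deriv[OF x] in simp)
    from has_derivative_scaleR[OF has_derivative_inner_left[OF snd, of i] this]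
    show "((\<lambda>z. (snd z \<bullet> i) *\<^sub>R H (fst z) i) has_derivative
        (\<lambda>d. (v \<bullet> i) *\<^sub>R T x (fst d) i + (snd d \<bullet> i) *\<^sub>R H x i)) (at (x, v))"
      by simp
  qed
  then have "((\<lambda>z. \<Sum>i\<in>Basis. (snd z \<bullet> i) *\<^sub>R H (fst z) i) has_derivative
      (\<lambda>d. T x (fst d) v + H x (snd d))) (at (x, v))"
    by (simp add: sum.distrib expand[OF linear_T2[OF x], symmetric] expand[OF linear_H[OF x], symmetric])
  then show "((\<lambda>z. H (fst z) (snd z)) has_derivative (\<lambda>d. T x (fst d) v + H x (snd d))) (at (x, v))"
  proof (rule has_derivative_transform_within_open)
    show "open (D \<times> (UNIV :: 'a set))" by (intro open_Times open_D open_UNIV)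
  qed (use x expand[OF linear_H, symmetric] in auto)
qed

text \<open>
  The curve along which the gradient moves with constant velocity \<open>s\<close>.  It exists for all times
  because the gradient maps the domain onto the whole space.  Its velocity \<open>V\<close> solves
  \<open>\<nabla>\<^sup>2F(X) V = s\<close>, and differentiation of this equation gives the acceleration \<open>V'\<close>.
\<close>

lemma dual_path:
  assumes x: "x \<in> D"
  obtains X V V' where "X 0 = x" "\<And>\<tau>. X \<tau> \<in> D" "\<And>\<tau>. G (X \<tau>) = G x + \<tau> *\<^sub>R s"
    "\<And>\<tau>. H (X \<tau>) (V \<tau>) = s" "\<And>\<tau>. (X has_vector_derivative V \<tau>) (at \<tau>)"
    "\<And>\<tau>. (V has_vector_derivative V' \<tau>) (at \<tau>)"
    "\<And>\<tau>. H (X \<tau>) (V' \<tau>) = - T (X \<tau>) (V \<tau>) (V \<tau>)"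
proof -
  define X where "X \<tau> = (SOME z. z \<in> D \<and> G z = G x + \<tau> *\<^sub>R s)" for \<tau> :: real
  have "X \<tau> \<in> D \<and> G (X \<tau>) = G x + \<tau> *\<^sub>R s" for \<tau>
    unfolding X_def by (rule someI_ex) (use G_surj in blast)
  then have XD: "X \<tau> \<in> D" and GX: "G (X \<tau>) = G x + \<tau> *\<^sub>R s" for \<tau> by auto
  define V where "V \<tau> = Hinv (X \<tau>) s" for \<tau>
  have HV: "H (X \<tau>) (V \<tau>) = s" for \<tau>
    using H_Hinv XD by (simp add: V_def)
  define V' where "V' \<tau> = Hinv (X \<tau>) (- T (X \<tau>) (V \<tau>) (V \<tau>))" for \<tau>
  let ?f = "\<lambda>z. (G (fst z), H (fst z) (snd z))"
  let ?S = "D \<times> (UNIV :: 'a set)"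
  define g where "g = inv_into ?S ?f"
  have inj: "inj_on ?f ?S"
  proof (rule inj_onI)
    fix a b assume ab: "a \<in> ?S" "b \<in> ?S" "?f a = ?f b"
    then have 1: "fst a = fst b" using G_inj by auto
    then have "snd a = snd b" using ab H_inj[of "fst a" "snd a" "snd b"] by auto
    with 1 show "a = b" by (rule prod_eqI)
  qed
  have gf: "g (?f z) = z" if "z \<in> ?S" for z
    unfolding g_def by (rule inv_into_f_f[OF inj that])
  have gs: "g (G x + \<tau> *\<^sub>R s, s) = (X \<tau>, V \<tau>)" for \<tau>
    using gf[of "(X \<tau>, V \<tau>)"] XD GX HV by simp
  have der: "((\<lambda>\<tau>. (X \<tau>, V \<tau>)) has_derivative (\<lambda>h. h *\<^sub>R (V \<tau>, V' \<tau>))) (at \<tau>)" for \<tau>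
  proof -
    define g' where "g' = (\<lambda>d. (Hinv (X \<tau>) (fst d), Hinv (X \<tau>) (snd d - T (X \<tau>) (Hinv (X \<tau>) (fst d)) (V \<tau>))))"
    have "(g has_derivative g') (at (?f (X \<tau>, V \<tau>)))"
    proof (rule has_derivative_inverse_strong[where S = ?S and f = ?f
        and f' = "\<lambda>d. (H (X \<tau>) (fst d), T (X \<tau>) (fst d) (V \<tau>) + H (X \<tau>) (snd d))"])
      show "open ?S" by (intro open_Times open_D open_UNIV)
      show "(X \<tau>, V \<tau>) \<in> ?S" using XD by simp
      show "continuous_on ?S ?f"
        using tangent_map_deriv has_derivative_continuous
        by (intro continuous_at_imp_continuous_on) fastforce
      show "(?f has_derivative (\<lambda>d. (H (X \<tau>) (fst d), T (X \<tau>) (fst d) (V \<tau>) + H (X \<tau>) (snd d)))) (at (X \<tau>, V \<tau>))"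
        by (rule tangent_map_deriv[OF XD])
      show "(\<lambda>d. (H (X \<tau>) (fst d), T (X \<tau>) (fst d) (V \<tau>) + H (X \<tau>) (snd d))) \<circ> g' = id"
        by (auto simp: fun_eq_iff g'_def H_Hinv[OF XD])
    qed (rule gf)
    then have g: "(g has_derivative g') (at (G x + \<tau> *\<^sub>R s, s))"
      using GX HV by simp
    have "((\<lambda>\<tau>. (G x + \<tau> *\<^sub>R s, s)) has_derivative (\<lambda>h. (h *\<^sub>R s, 0))) (at \<tau>)"
      by (auto intro!: derivative_eq_intros)
    from has_derivative_compose[OF this g]
    have d: "((\<lambda>\<tau>. (X \<tau>, V \<tau>)) has_derivative (\<lambda>h. g' (h *\<^sub>R s, 0))) (at \<tau>)"
      unfolding gs .
    have val: "g' (1 *\<^sub>R s, 0) = (V \<tau>, V' \<tau>)"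
      by (simp add: g'_def V_def V'_def)
    have "g' (h *\<^sub>R s, 0) = h *\<^sub>R (V \<tau>, V' \<tau>)" for h
      using linear_scale[OF has_derivative_linear[OF d], of h 1] unfolding val by simp
    then show ?thesis
      using d by simp
  qed
  show ?thesis
  proof (rule that[of X V V'])
    show "X 0 = x" using G_inj[OF XD x, of 0] GX[of 0] by simp
    show "(X has_vector_derivative V \<tau>) (at \<tau>)" for \<tau>
      using has_derivative_fst[OF der] by (simp add: has_vector_derivative_def)
    show "(V has_vector_derivative V' \<tau>) (at \<tau>)" for \<tau>
      using has_derivative_snd[OF der] by (simp add: has_vector_derivative_def)
    show "H (X \<tau>) (V' \<tau>) = - T (X \<tau>) (V \<tau>) (V \<tau>)" for \<tau>
      using H_Hinv XD by (simp add: V'_def)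
  qed (use XD GX HV in auto)
qed

section \<open>Comparison of local norms\<close>

text \<open>
  The hypothesis on \<open>m'\<close> holds both for straight segments and for the curves of \<open>dual_path\<close>; it bounds the
  change of the local speed, and the mixed bound on the third derivative transfers this to the local norm
  of any fixed vector \<open>h\<close>.
\<close>

lemma N_comparison_along_path:
  assumes X: "\<And>\<tau>. 0 \<le> \<tau> \<Longrightarrow> \<tau> \<le> 1 \<Longrightarrow> X \<tau> \<in> D"
    "\<And>\<tau>. 0 \<le> \<tau> \<Longrightarrow> \<tau> \<le> 1 \<Longrightarrow> (X has_vector_derivative V \<tau>) (at \<tau>)"
    and V: "\<And>\<tau>. 0 \<le> \<tau> \<Longrightarrow> \<tau> \<le> 1 \<Longrightarrow> V \<tau> \<noteq> 0"
    and m: "\<And>\<tau>. 0 \<le> \<tau> \<Longrightarrow> \<tau> \<le> 1 \<Longrightarrow> ((\<lambda>\<tau>. V \<tau> \<bullet> H (X \<tau>) (V \<tau>)) has_real_derivative m' \<tau>) (at \<tau>)"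
    and m': "\<And>\<tau>. 0 \<le> \<tau> \<Longrightarrow> \<tau> \<le> 1 \<Longrightarrow> \<bar>m' \<tau>\<bar> = \<bar>T (X \<tau>) (V \<tau>) (V \<tau>) \<bullet> V \<tau>\<bar>"
    and \<rho>: "N (X 0) (V 0) < 1" and \<tau>: "0 \<le> \<tau>" "\<tau> \<le> 1"
  defines "\<rho> \<equiv> N (X 0) (V 0)"
  shows "N (X \<tau>) (V \<tau>) \<le> \<rho> / (1 - \<tau> * \<rho>)"
    and "(1 - \<tau> * \<rho>) * N (X \<tau>) h \<le> N (X 0) h"
    and "(1 - \<tau> * \<rho>) * N (X 0) h \<le> N (X \<tau>) h"
proof -
  have \<rho>0: "0 \<le> \<rho>" using X(1)[of 0] by (simp add: \<rho>_def)
  have c: "1 - s * \<rho> > 0" if "0 \<le> s" "s \<le> 1" for s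
    using that \<rho> \<rho>0 unfolding \<rho>_def by (metis diff_gt_0_iff_gt le_less_trans mult_left_le_one_le)
  have speed: "N (X s) (V s) \<le> \<rho> / (1 - s * \<rho>)" if s: "0 \<le> s" "s \<le> 1" for s
    unfolding N_def
  proof (rule speed_bound_along_path[OF m])
    show "\<rho> = sqrt (V 0 \<bullet> H (X 0) (V 0))" by (simp add: \<rho>_def N_def)
    show "\<rho> < 1" using \<rho> by (simp add: \<rho>_def)
  next
    fix r :: real assume r: "0 \<le> r" "r \<le> 1"
    show "0 < V r \<bullet> H (X r) (V r)"
      using nondegenerate X V r by blast
    show "\<bar>m' r\<bar> \<le> 2 * (V r \<bullet> H (X r) (V r)) * sqrt (V r \<bullet> H (X r) (V r))"
      using third_bound_N[OF X(1)[OF r], of "V r"] m'[OF r] by (simp add: N_def)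
  qed (use s in auto)
  show "N (X \<tau>) (V \<tau>) \<le> \<rho> / (1 - \<tau> * \<rho>)" using speed \<tau> .
  define \<phi> where "\<phi> s = h \<bullet> H (X s) h" for s
  have \<phi>: "(\<phi> has_real_derivative h \<bullet> T (X s) (V s) h) (at s)" if "0 \<le> s" "s \<le> 1" for s
    unfolding \<phi>_def by (rule quad_along_path) (use X that in auto)
  have \<phi>': "\<bar>h \<bullet> T (X s) (V s) h\<bar> \<le> 2 * \<rho> / (1 - s * \<rho>) * \<phi> s" if s: "0 \<le> s" "s \<le> 1" for s
  proof -
    have "\<bar>h \<bullet> T (X s) (V s) h\<bar> \<le> 2 * N (X s) (V s) * \<phi> s"
      using third_mixed[OF X(1)[OF s], of "V s" h] by (simp add: \<phi>_def N_sq X s inner_commute)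
    also have "\<dots> \<le> 2 * (\<rho> / (1 - s * \<rho>)) * \<phi> s"
      using speed[OF s] psd[OF X(1)[OF s], of h] by (intro mult_right_mono mult_left_mono) (auto simp: \<phi>_def)
    finally show ?thesis by simp
  qed
  have g: "(1 - \<tau> * \<rho>)^2 * \<phi> \<tau> \<le> \<phi> 0" "(1 - \<tau> * \<rho>)^2 * \<phi> 0 \<le> \<phi> \<tau>"
    using gronwall_along_path[OF \<phi> \<phi>' \<rho>0 _ \<tau>] \<rho> by (auto simp: \<rho>_def)
  have N\<phi>: "N (X s) h = sqrt (\<phi> s)" for s by (simp add: N_def \<phi>_def)
  show "(1 - \<tau> * \<rho>) * N (X \<tau>) h \<le> N (X 0) h"
    using real_sqrt_le_mono[OF g(1)] c[OF \<tau>] by (simp add: real_sqrt_mult N\<phi>)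
  show "(1 - \<tau> * \<rho>) * N (X 0) h \<le> N (X \<tau>) h"
    using real_sqrt_le_mono[OF g(2)] c[OF \<tau>] by (simp add: real_sqrt_mult N\<phi>)
qed

lemma local_norm_compare:
  assumes x: "x \<in> D" and y: "y \<in> D" and r: "N x (y - x) < 1"
  shows "(1 - N x (y - x)) * N y h \<le> N x h" "(1 - N x (y - x)) * N x h \<le> N y h"
proof -
  define w where "w = y - x"
  have inD: "x + \<tau> *\<^sub>R w \<in> D" if "0 \<le> \<tau>" "\<tau> \<le> 1" for \<tau>
  proof -
    have "(1 - \<tau>) *\<^sub>R x + \<tau> *\<^sub>R y \<in> D"
      using convexD_alt[OF convex_D x y that] .
    then show ?thesis by (simp add: w_def algebra_simps)
  qed
  have "(1 - N x w) * N y h \<le> N x h \<and> (1 - N x w) * N x h \<le> N y h"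
  proof (cases "w = 0")
    case False
    have X': "((\<lambda>\<tau>. x + \<tau> *\<^sub>R w) has_vector_derivative w) (at \<tau>)" for \<tau>
      by (auto intro!: derivative_eq_intros)
    have y: "x + 1 *\<^sub>R w = y" by (simp add: w_def)
    have m: "((\<lambda>\<tau>. w \<bullet> H (x + \<tau> *\<^sub>R w) w) has_real_derivative w \<bullet> T (x + \<tau> *\<^sub>R w) w w) (at \<tau>)"
      if "0 \<le> \<tau>" "\<tau> \<le> 1" for \<tau>
      using quad_along_path[OF X' inD[OF that]] .
    have r': "N (x + 0 *\<^sub>R w) w < 1" using r by (simp add: w_def)
    have "(1 - 1 * N (x + 0 *\<^sub>R w) w) * N (x + 1 *\<^sub>R w) h \<le> N (x + 0 *\<^sub>R w) h"
      by (rule N_comparison_along_path(2)[OF inD X' False m _ r']) (auto simp: inner_commute)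
    moreover have "(1 - 1 * N (x + 0 *\<^sub>R w) w) * N (x + 0 *\<^sub>R w) h \<le> N (x + 1 *\<^sub>R w) h"
      by (rule N_comparison_along_path(3)[OF inD X' False m _ r']) (auto simp: inner_commute)
    ultimately show ?thesis
      unfolding y by simp
  qed (use y in \<open>simp add: w_def\<close>)
  then show "(1 - N x (y - x)) * N y h \<le> N x h" "(1 - N x (y - x)) * N x h \<le> N y h"
    by (auto simp: w_def)
qed

text \<open>
  Here \<open>N x v\<close> is the dual local norm of the difference of the two gradients.  On the straight segment
  from \<open>x\<close> to \<open>y\<close> one would only get the factor \<open>1 - \<rho> / (1 - \<rho>)\<close>; the dual path gives \<open>1 - \<rho>\<close>.
  For the second claim the bound on the acceleration is integrated twice, paired with the error vector
  itself.
\<close>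

lemma dual_norm_compare:
  assumes x: "x \<in> D" and y: "y \<in> D" and v: "H x v = G y - G x" and r: "N x v < 1"
  shows "(1 - N x v) * N y h \<le> N x h" "N x (y - x - v) \<le> (N x v)^2 / (1 - N x v)"
proof -
  define \<rho> where "\<rho> = N x v"
  have \<rho>: "0 \<le> \<rho>" "\<rho> < 1" using x r by (auto simp: \<rho>_def)
  have c: "1 - s * \<rho> > 0" if "0 \<le> s" "s \<le> 1" for s
    using that \<rho> by (metis diff_gt_0_iff_gt le_less_trans mult_left_le_one_le)
  define s where "s = G y - G x"
  obtain X V V' where X0: "X 0 = x" and XD: "\<And>\<tau>. X \<tau> \<in> D" and GX: "\<And>\<tau>. G (X \<tau>) = G x + \<tau> *\<^sub>R s"
    and HV: "\<And>\<tau>. H (X \<tau>) (V \<tau>) = s" and X': "\<And>\<tau>. (X has_vector_derivative V \<tau>) (at \<tau>)"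
    and V': "\<And>\<tau>. (V has_vector_derivative V' \<tau>) (at \<tau>)"
    and HV': "\<And>\<tau>. H (X \<tau>) (V' \<tau>) = - T (X \<tau>) (V \<tau>) (V \<tau>)"
    using dual_path[OF x] by metis
  have X1: "X 1 = y"
    using G_inj[OF XD y] GX[of 1] by (simp add: s_def)
  have V0: "V 0 = v"
    using H_inj[OF x] HV[of 0] X0 v by (simp add: s_def)
  have "(1 - \<rho>) * N y h \<le> N x h \<and> N x (y - x - v) \<le> \<rho>^2 / (1 - \<rho>)"
  proof (cases "v = 0")
    case True
    then have "G x = G y" using v x by (simp add: H_simps)
    then show ?thesis using G_inj[OF x y] True x by (simp add: \<rho>_def)
  next
    case False
    then have s: "s \<noteq> 0"
      using H_inj[OF x, of v 0] v x by (auto simp: s_def H_simps)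
    then have Vne: "V \<tau> \<noteq> 0" for \<tau>
      using HV[of \<tau>] XD[of \<tau>] by (auto simp: H_simps)
    have inner': "((\<lambda>\<tau>. k \<bullet> V \<tau>) has_real_derivative k \<bullet> V' \<tau>) (at \<tau>)"
      "((\<lambda>\<tau>. k \<bullet> X \<tau>) has_real_derivative k \<bullet> V \<tau>) (at \<tau>)" for k \<tau>
      using has_derivative_inner_right[OF V'[unfolded has_vector_derivative_def], of k]
        has_derivative_inner_right[OF X'[unfolded has_vector_derivative_def], of k]
      unfolding has_field_derivative_def
      by (simp_all add: mult_commute_abs)
    have m: "((\<lambda>\<tau>. V \<tau> \<bullet> H (X \<tau>) (V \<tau>)) has_real_derivative s \<bullet> V' \<tau>) (at \<tau>)" for \<tau>
      using inner'(1)[of s \<tau>] by (simp add: HV inner_commute)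
    have m': "\<bar>s \<bullet> V' \<tau>\<bar> = \<bar>T (X \<tau>) (V \<tau>) (V \<tau>) \<bullet> V \<tau>\<bar>" for \<tau>
    proof -
      have "s \<bullet> V' \<tau> = V \<tau> \<bullet> H (X \<tau>) (V' \<tau>)"
        using H_sym[OF XD] HV by (metis inner_commute)
      then show ?thesis by (simp add: HV' inner_commute)
    qed
    note cmp = N_comparison_along_path[OF XD X' Vne m m', unfolded X0 V0, folded \<rho>_def, OF \<rho>(2)]
    have first: "(1 - \<rho>) * N y h \<le> N x h"
      using cmp(2)[of 1 h] by (simp add: X1)
    \<comment> \<open>The acceleration solves \<open>H V' = - T V V\<close>; its local norm is at most twice the squared speed, and the
       factor \<open>1 - \<tau> \<rho>\<close> transports it back to the norm at \<open>x\<close>.\<close>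
    have accel: "N x (V' \<tau>) \<le> 2 * \<rho>^2 / (1 - \<tau> * \<rho>)^3" if \<tau>: "0 \<le> \<tau>" "\<tau> \<le> 1" for \<tau>
    proof -
      let ?n = "N (X \<tau>)"
      have "(?n (V' \<tau>))^2 = - (T (X \<tau>) (V \<tau>) (V \<tau>) \<bullet> V' \<tau>)"
        by (simp add: N_sq[OF XD] HV' inner_commute)
      also have "\<dots> = - (T (X \<tau>) (V' \<tau>) (V \<tau>) \<bullet> V \<tau>)"
        using T_inner[OF XD] T_outer[OF XD] by metis
      also have "\<dots> \<le> 2 * ?n (V' \<tau>) * (?n (V \<tau>))^2"
        using third_mixed[OF XD, of \<tau> "V' \<tau>" "V \<tau>"] by simp
      finally have "?n (V' \<tau>) * ?n (V' \<tau>) \<le> ?n (V' \<tau>) * (2 * (?n (V \<tau>))^2)"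
        by (simp add: power2_eq_square mult_ac)
      then have 1: "?n (V' \<tau>) \<le> 2 * (?n (V \<tau>))^2"
        using N_nonneg[OF XD, of \<tau> "V' \<tau>"] by (cases "?n (V' \<tau>) = 0") (auto simp: mult_le_cancel_left)
      have "(?n (V \<tau>))^2 \<le> (\<rho> / (1 - \<tau> * \<rho>))^2"
        using cmp(1)[OF \<tau>] XD by (intro power_mono) auto
      then have "(1 - \<tau> * \<rho>) * N x (V' \<tau>) \<le> 2 * (\<rho> / (1 - \<tau> * \<rho>))^2"
        using 1 cmp(3)[OF \<tau>, of "V' \<tau>"] by linarith
      then have "N x (V' \<tau>) \<le> 2 * (\<rho> / (1 - \<tau> * \<rho>))^2 / (1 - \<tau> * \<rho>)"
        using c[OF \<tau>] by (simp add: pos_le_divide_eq mult.commute)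
      then show ?thesis
        by (simp add: power_divide power3_eq_cube power2_eq_square mult.assoc)
    qed
    define k where "k = y - x - v"
    let ?k = "H x k"
    have kb: "k \<bullet> H x u \<le> N x k * N x u" for u by (rule cauchy_schwarz[OF x])
    have ks: "?k \<bullet> u = k \<bullet> H x u" for u
      using H_sym[OF x, of u k] by (simp add: inner_commute)
    have vel: "?k \<bullet> V \<tau> - ?k \<bullet> v \<le> N x k * (\<rho> / (1 - \<tau> * \<rho>)^2 - \<rho>)" if \<tau>: "0 \<le> \<tau>" "\<tau> \<le> 1" for \<tau>
    proof -
      have "?k \<bullet> V \<tau> - N x k * (\<rho> / (1 - \<tau> * \<rho>)^2) \<le> ?k \<bullet> V 0 - N x k * (\<rho> / (1 - 0 * \<rho>)^2)"
      proof (rule DERIV_nonpos_imp_nonincreasing[OF \<tau>(1)])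
        fix r assume r: "0 \<le> r" "r \<le> \<tau>"
        have cr: "1 - r * \<rho> > 0" using c r \<tau> by simp
        have simplify: "(0 * q^2 - \<rho> * (2 * q * - \<rho>)) / (q^2 * q^2) = 2 * \<rho>^2 / q^3" if "q > 0" for q :: real
          using that by (simp add: power2_eq_square power3_eq_cube mult_ac)
        have "((\<lambda>r. (1 - r * \<rho>)^2) has_real_derivative 2 * (1 - r * \<rho>) * - \<rho>) (at r)"
          by (auto intro!: derivative_eq_intros)
        from DERIV_divide[OF DERIV_const[of \<rho>] this]
        have "((\<lambda>r. \<rho> / (1 - r * \<rho>)^2) has_real_derivative
            (0 * (1 - r * \<rho>)^2 - \<rho> * (2 * (1 - r * \<rho>) * - \<rho>)) / ((1 - r * \<rho>)^2 * (1 - r * \<rho>)^2)) (at r)"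
          using cr by simp
        then have "((\<lambda>r. \<rho> / (1 - r * \<rho>)^2) has_real_derivative 2 * \<rho>^2 / (1 - r * \<rho>)^3) (at r)"
          unfolding simplify[OF cr] .
        then have d: "((\<lambda>\<tau>. ?k \<bullet> V \<tau> - N x k * (\<rho> / (1 - \<tau> * \<rho>)^2)) has_real_derivative
            ?k \<bullet> V' r - N x k * (2 * \<rho>^2 / (1 - r * \<rho>)^3)) (at r)"
          by (intro DERIV_diff DERIV_cmult inner')
        have "?k \<bullet> V' r \<le> N x k * N x (V' r)" unfolding ks by (rule kb)
        also have "\<dots> \<le> N x k * (2 * \<rho>^2 / (1 - r * \<rho>)^3)"
          by (rule mult_left_mono[OF accel N_nonneg[OF x]]) (use r \<tau> in linarith)+
        finally have "?k \<bullet> V' r - N x k * (2 * \<rho>^2 / (1 - r * \<rho>)^3) \<le> 0"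
          by (simp only: diff_le_0_iff_le)
        with d show "\<exists>d. ((\<lambda>\<tau>. ?k \<bullet> V \<tau> - N x k * (\<rho> / (1 - \<tau> * \<rho>)^2)) has_real_derivative d) (at r) \<and> d \<le> 0"
          by (intro exI conjI)
      qed
      then show ?thesis by (simp add: V0 right_diff_distrib)
    qed
    define \<psi> where "\<psi> r = (?k \<bullet> X r - r * (?k \<bullet> v)) - N x k * (1 / (1 - r * \<rho>) - r * \<rho>)" for r
    have "\<psi> 1 \<le> \<psi> 0"
    proof (rule DERIV_nonpos_imp_nonincreasing[of 0 1 \<psi>])
      fix r :: real assume r: "0 \<le> r" "r \<le> 1"
      have cr: "1 - r * \<rho> > 0" using c r by simp
      have d1: "((\<lambda>r. 1 / (1 - r * \<rho>) - r * \<rho>) has_real_derivative \<rho> / (1 - r * \<rho>)^2 - \<rho>) (at r)"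
        using cr by (auto intro!: derivative_eq_intros simp: power2_eq_square)
      have d2: "((\<lambda>r. ?k \<bullet> X r - r * (?k \<bullet> v)) has_real_derivative ?k \<bullet> V r - ?k \<bullet> v) (at r)"
        by (auto intro!: derivative_eq_intros inner')
      have "(\<psi> has_real_derivative
          (?k \<bullet> V r - ?k \<bullet> v) - N x k * (\<rho> / (1 - r * \<rho>)^2 - \<rho>)) (at r)"
        unfolding \<psi>_def by (rule DERIV_diff[OF d2 DERIV_cmult[OF d1]])
      then show "\<exists>d. (\<psi> has_real_derivative d) (at r) \<and> d \<le> 0"
        using vel[OF r] by (intro exI conjI) (assumption, simp only: diff_le_0_iff_le)
    qed simp
    then have "?k \<bullet> X 1 - ?k \<bullet> X 0 - ?k \<bullet> v \<le> N x k * (1 / (1 - \<rho>) - \<rho> - 1)"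
      by (simp add: \<psi>_def right_diff_distrib)
    then have "?k \<bullet> k \<le> N x k * (1 / (1 - \<rho>) - \<rho> - 1)"
      by (simp add: X0 X1 k_def inner_diff_right)
    also have "1 / (1 - \<rho>) - \<rho> - 1 = \<rho>^2 / (1 - \<rho>)"
      using \<rho> by (simp add: field_simps power2_eq_square)
    finally have "N x k * N x k \<le> N x k * (\<rho>^2 / (1 - \<rho>))"
      using N_sq[OF x, of k] by (simp add: inner_commute power2_eq_square)
    then have "N x k \<le> \<rho>^2 / (1 - \<rho>)"
    proof (cases "N x k = 0")
      case False
      then have "0 < N x k" using N_nonneg[OF x, of k] by simp
      with \<open>N x k * N x k \<le> N x k * (\<rho>^2 / (1 - \<rho>))\<close> show ?thesis
        by (rule mult_left_le_imp_le)
    qed (use \<rho> in simp)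
    with first show ?thesis by (simp add: k_def)
  qed
  then show "(1 - N x v) * N y h \<le> N x h" "N x (y - x - v) \<le> (N x v)^2 / (1 - N x v)"
    by (auto simp: \<rho>_def)
qed

section \<open>The inexact Newton estimate\<close>

text \<open>
  The symmetric form \<open>B\<close> of the difference of the two Hessians is at most \<open>\<kappa>\<close> times the form of \<open>H x\<close> on the
  diagonal, hence also off the diagonal by polarization.
\<close>

lemma frozen_hessian_error:
  assumes x: "x \<in> D" and y: "y \<in> D" and c: "0 < c" "c \<le> 1"
    and cmp: "\<And>h. c * N y h \<le> N x h" "\<And>h. c * N x h \<le> N y h"
    and eq: "H x v = H y u"
  shows "N x (v - u) \<le> (1 / c^2 - 1) * N x u"
proof -
  define \<kappa> where "\<kappa> = 1 / c^2 - 1"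
  define d where "d = v - u"
  define B where "B a b = a \<bullet> H y b - a \<bullet> H x b" for a b
  have \<kappa>: "0 \<le> \<kappa>" using c by (simp add: \<kappa>_def power_le_one)
  have Bquad: "\<bar>B h h\<bar> \<le> \<kappa> * (N x h)^2" for h
  proof -
    have "(c * N y h)^2 \<le> (N x h)^2" "(c * N x h)^2 \<le> (N y h)^2"
      using cmp c x y by (auto intro!: power_mono)
    then have 1: "(N y h)^2 \<le> (1 / c^2) * (N x h)^2" "c^2 * (N x h)^2 \<le> (N y h)^2"
      using c by (simp_all add: power_mult_distrib pos_le_divide_eq mult.commute)
    have "0 \<le> (1 / c - c)^2" by simp
    also have "(1 / c - c)^2 = 1 / c^2 - 2 + c^2"
      using c by (simp add: power2_eq_square field_simps)
    finally have "1 - c^2 \<le> \<kappa>" by (simp add: \<kappa>_def)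
    then have "(1 - c^2) * (N x h)^2 \<le> \<kappa> * (N x h)^2" by (rule mult_right_mono) simp
    then show ?thesis
      using 1 unfolding B_def \<kappa>_def N_sq[OF x, symmetric] N_sq[OF y, symmetric]
      by (simp add: abs_le_iff left_diff_distrib)
  qed
  have Bdu: "B d u = (N x d)^2"
    unfolding B_def N_sq[OF x] eq[symmetric] by (simp add: d_def H_simps[OF x] inner_diff_right)
  have "N x d \<le> \<kappa> * N x u"
  proof (cases "u = 0 \<or> d = 0")
    case True
    then show ?thesis
    proof
      assume "u = 0"
      then have "H x v = H x 0" using eq by (simp add: H_simps x y)
      then have "v = 0" using H_inj[OF x] by blast
      then show ?thesis using \<open>u = 0\<close> x by (simp add: d_def)
    qed (use x \<kappa> in simp)
  next
    case False
    then have pos: "0 < N x u" "0 < N x d" using N_pos x by auto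
    \<comment> \<open>The scaling that gives both arguments of the form the same norm.\<close>
    define t where "t = N x d / N x u"
    have t: "0 < t" using pos by (simp add: t_def)
    let ?w = "t *\<^sub>R u"
    have Nw: "(N x ?w)^2 = (N x d)^2"
      using pos t by (simp add: N_scale[OF x] t_def)
    have "4 * B d ?w = B (d + ?w) (d + ?w) - B (d - ?w) (d - ?w)"
      using H_sym[OF x, of ?w d] H_sym[OF y, of ?w d]
      unfolding B_def by (simp only: H_simps[OF x] H_simps[OF y] inner_add_left inner_add_right
          inner_diff_left inner_diff_right) (simp add: algebra_simps)
    also have "\<dots> \<le> \<kappa> * (N x (d + ?w))^2 + \<kappa> * (N x (d - ?w))^2"
      using Bquad[of "d + ?w"] Bquad[of "d - ?w"] by linarith
    also have "\<dots> = \<kappa> * (2 * (N x d)^2 + 2 * (N x ?w)^2)"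
      unfolding N_sq[OF x] by (simp add: H_simps[OF x] inner_add_left inner_add_right
          inner_diff_left inner_diff_right algebra_simps)
    finally have "B d ?w \<le> \<kappa> * (N x d)^2" unfolding Nw by simp
    moreover have "B d ?w = t * (N x d)^2"
      using Bdu by (simp add: B_def H_simps x y flip: right_diff_distrib)
    ultimately have "t \<le> \<kappa>" using pos by simp
    then show ?thesis using pos by (simp add: t_def pos_divide_le_eq)
  qed
  then show ?thesis by (simp add: d_def \<kappa>_def)
qed

text \<open>
  \<open>x1\<close> and \<open>xp\<close> are the exact points before and after the step, \<open>xb\<close> is the approximation of \<open>x1\<close> and \<open>u\<close>
  is the step computed with the Hessian at \<open>xb\<close>.  With \<open>v\<close> the step computed with the Hessian at
  \<open>x1\<close>, the error splits into \<open>x1 - xb\<close> (inexactness), \<open>xp - x1 - v\<close> (linearization) and \<open>v - u\<close>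
  (wrong Hessian).  All three are measured at \<open>x1\<close> and transported to \<open>xp\<close> at the price of a
  factor \<open>1 + \<theta>\<close>.
\<close>

lemma inexact_newton_estimate:
  assumes x1: "x1 \<in> D" and xb: "xb \<in> D" and xp: "xp \<in> D"
    and \<delta>: "N x1 (xb - x1) \<le> \<delta>" "\<delta> < 1"
    and step: "H xb u = G xp - G x1" and l: "N xb u < 1 - \<delta>"
  defines "\<theta> \<equiv> N xb u / (1 - \<delta> - N xb u)"
  shows "N xp (xp - xb - u) \<le> \<delta> * (1 + \<theta>) + \<theta>^2 + (1 / (1 - \<delta>)^2 - 1) * \<theta>"
proof -
  define l where "l = N xb u"
  define s where "s = l / (1 - \<delta>)"
  define v where "v = Hinv x1 (H xb u)"
  define \<rho> where "\<rho> = N x1 v"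
  have \<delta>0: "0 \<le> \<delta>" using \<delta> N_nonneg[OF x1] order_trans by blast
  have l0: "0 \<le> l" "l < 1 - \<delta>" using l xb by (auto simp: l_def)
  have v: "H x1 v = H xb u" using H_Hinv[OF x1] by (simp add: v_def)
  have r: "N x1 (xb - x1) < 1" using \<delta> by simp
  have cmp: "(1 - \<delta>) * N xb h \<le> N x1 h" "(1 - \<delta>) * N x1 h \<le> N xb h" for h
  proof -
    have "(1 - \<delta>) * N xb h \<le> (1 - N x1 (xb - x1)) * N xb h"
      using \<delta> xb by (intro mult_right_mono) auto
    then show "(1 - \<delta>) * N xb h \<le> N x1 h" using local_norm_compare(1)[OF x1 xb r, of h] by linarith
    have "(1 - \<delta>) * N x1 h \<le> (1 - N x1 (xb - x1)) * N x1 h"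
      using \<delta> x1 by (intro mult_right_mono) auto
    then show "(1 - \<delta>) * N x1 h \<le> N xb h" using local_norm_compare(2)[OF x1 xb r, of h] by linarith
  qed
  have \<rho>0: "0 \<le> \<rho>" using x1 by (simp add: \<rho>_def)
  have "(1 - \<delta>) * \<rho> \<le> l"
  proof (cases "\<rho> = 0")
    case False
    have "\<rho>^2 = v \<bullet> H xb u" unfolding \<rho>_def N_sq[OF x1] v ..
    also have "\<dots> \<le> N xb v * l" unfolding l_def by (rule cauchy_schwarz[OF xb])
    finally have "(1 - \<delta>) * \<rho>^2 \<le> ((1 - \<delta>) * N xb v) * l"
      using \<delta> by (simp add: mult_left_mono mult.assoc)
    also have "\<dots> \<le> \<rho> * l" using cmp(1)[of v] l0 by (intro mult_right_mono) (auto simp: \<rho>_def)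
    finally have "\<rho> * ((1 - \<delta>) * \<rho>) \<le> \<rho> * l" by (simp add: power2_eq_square mult_ac)
    then show ?thesis using False \<rho>0 by simp
  qed (use l0 in simp)
  then have \<rho>s: "\<rho> \<le> s" using \<delta> by (simp add: s_def pos_le_divide_eq mult.commute)
  have s: "0 \<le> s" "s < 1" using l0 \<delta> by (auto simp: s_def)
  have \<theta>: "\<theta> = l / (1 - \<delta> - l)" by (simp add: \<theta>_def l_def)
  have \<theta>0: "0 \<le> \<theta>" using l0 by (simp add: \<theta>)
  have ts: "1 / (1 - s) = 1 + \<theta>"
    using l0 \<delta> by (simp add: s_def \<theta> field_simps)
  have "1 + \<theta> = (1 - \<delta>) / (1 - \<delta> - l)"
    using l0 by (simp add: \<theta> field_simps)
  then have st: "(1 + \<theta>) * s = \<theta>"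
    using \<delta> by (simp add: s_def \<theta>)
  have \<rho>1: "N x1 v < 1" using \<rho>s s by (simp add: \<rho>_def)
  note dual = dual_norm_compare[OF x1 xp v[unfolded step] \<rho>1, folded \<rho>_def]
  have inv: "1 / (1 - \<rho>) \<le> 1 + \<theta>"
    unfolding ts[symmetric] using \<rho>s s by (intro divide_left_mono) auto
  have to_xp: "N xp h \<le> (1 + \<theta>) * N x1 h" for h
  proof -
    have "N xp h \<le> (1 / (1 - \<rho>)) * N x1 h"
      using dual(1)[of h] \<rho>s s by (simp add: pos_le_divide_eq mult.commute)
    also have "\<dots> \<le> (1 + \<theta>) * N x1 h"
      using inv x1 by (intro mult_right_mono) auto
    finally show ?thesis .
  qed
  have "N x1 (xp - x1 - v) \<le> (1 / (1 - \<rho>)) * \<rho>^2" using dual(2) by simp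
  also have "\<dots> \<le> (1 + \<theta>) * s^2"
    using inv \<rho>s \<rho>0 \<theta>0 by (intro mult_mono power_mono) auto
  finally have t2: "(1 + \<theta>) * N x1 (xp - x1 - v) \<le> (1 + \<theta>) * ((1 + \<theta>) * s^2)"
    using \<theta>0 by (intro mult_left_mono) auto
  also have "\<dots> = ((1 + \<theta>) * s)^2" by (simp add: power2_eq_square mult_ac)
  also have "\<dots> = \<theta>^2" unfolding st ..
  finally have t2: "(1 + \<theta>) * N x1 (xp - x1 - v) \<le> \<theta>^2" .
  have \<kappa>: "0 \<le> 1 / (1 - \<delta>)^2 - 1" using \<delta> \<delta>0 by (simp add: power_le_one)
  have "N x1 (v - u) \<le> (1 / (1 - \<delta>)^2 - 1) * N x1 u"
    by (rule frozen_hessian_error[OF x1 xb _ _ cmp v]) (use \<delta> \<delta>0 in auto)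
  also have "\<dots> \<le> (1 / (1 - \<delta>)^2 - 1) * s"
    using cmp(2)[of u] \<delta> \<kappa> by (intro mult_left_mono) (simp_all add: s_def l_def pos_le_divide_eq mult.commute)
  finally have "(1 + \<theta>) * N x1 (v - u) \<le> (1 + \<theta>) * ((1 / (1 - \<delta>)^2 - 1) * s)"
    using \<theta>0 by (intro mult_left_mono) auto
  also have "\<dots> = (1 / (1 - \<delta>)^2 - 1) * ((1 + \<theta>) * s)" by (rule mult.left_commute)
  finally have t3: "(1 + \<theta>) * N x1 (v - u) \<le> (1 / (1 - \<delta>)^2 - 1) * \<theta>" unfolding st .
  have t1: "(1 + \<theta>) * N x1 (x1 - xb) \<le> \<delta> * (1 + \<theta>)"
    using \<delta>(1) \<theta>0 N_minus_commute[OF x1, of x1 xb] by (simp add: mult.commute mult_right_mono)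
  have split: "xp - xb - u = (x1 - xb) + ((xp - x1 - v) + (v - u))" by simp
  have "N xp (xp - xb - u) \<le> N xp (x1 - xb) + (N xp (xp - x1 - v) + N xp (v - u))"
    unfolding split by (rule order_trans[OF N_triangle[OF xp] add_left_mono[OF N_triangle[OF xp]]])
  then show ?thesis
    using t1 t2 t3 to_xp[of "x1 - xb"] to_xp[of "xp - x1 - v"] to_xp[of "v - u"] by linarith
qed

end

section \<open>Barriers of compact convex sets and their sums\<close>

lemma has_derivative_gradient:
  assumes "f differentiable (at x)"
  shows "(f has_derivative (\<lambda>h. gradient f x \<bullet> h)) (at x)"
proof -
  obtain f' where f': "(f has_derivative f') (at x)"
    using assms by (auto simp: differentiable_def)
  interpret linear f' using f' by (rule has_derivative_linear)
  define d where "d = (\<Sum>i\<in>Basis. f' i *\<^sub>R i)"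
  have "f' = (\<lambda>h. h \<bullet> d)"
  proof
    fix h
    have "f' h = f' (\<Sum>i\<in>Basis. (h \<bullet> i) *\<^sub>R i)" by (simp add: euclidean_representation)
    also have "\<dots> = h \<bullet> d" by (simp add: sum scaleR d_def inner_sum_right mult.commute)
    finally show "f' h = h \<bullet> d" .
  qed
  then have d: "GDERIV f x :> d"
    using f' by (simp add: gderiv_def)
  have "gradient f x = d"
    unfolding gradient_def
  proof (rule the_equality)
    show "GDERIV f x :> d" by (rule d)
    fix e assume "GDERIV f x :> e"
    then have "(\<lambda>h. h \<bullet> e) = (\<lambda>h. h \<bullet> d)"
      using d has_derivative_unique unfolding gderiv_def by blast
    then show "e = d" by (metis vector_eq_ldot)
  qed
  then show ?thesis
    using d by (simp add: gderiv_def inner_commute)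
qed

lemma gradient_eq:
  assumes "(f has_derivative (\<lambda>h. g \<bullet> h)) (at x)"
  shows "gradient f x = g"
proof -
  have "(\<lambda>h. gradient f x \<bullet> h) = (\<lambda>h. g \<bullet> h)"
    using has_derivative_gradient assms has_derivative_unique differentiable_def by blast
  then show ?thesis by (metis vector_eq_rdot)
qed

lemma hessian_eq:
  assumes "(gradient f has_derivative f') (at x)"
  shows "hessian f x *v h = f' h"
proof -
  have "frechet_derivative (gradient f) (at x) = f'"
    using frechet_derivative_at[OF assms] ..
  moreover have "linear f'" using assms has_derivative_linear by blast
  ultimately show ?thesis by (simp add: hessian_def matrix_works)
qed

text \<open>
  The frontier of \<open>interior X\<close> is part of the frontier of \<open>X\<close>, where the barrier tends to infinity.
\<close>

lemma self_concordant_of_barrier: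
  assumes bar: "self_concordant_barrier X \<nu> F" and X: "bounded X" "convex X" "interior X \<noteq> {}"
  shows "self_concordant (interior X) F (gradient F) (\<lambda>x h. hessian F x *v h)
    (\<lambda>x w k. frechet_derivative (hessian F) (at x) w *v k)"
proof
  show "open (interior X)" "convex (interior X)" "bounded (interior X)" "interior X \<noteq> {}"
    using X by (auto simp: convex_interior bounded_interior)
  have C3: "C3_on (interior X) F" and cv: "convex_on (interior X) F"
    using bar by (auto simp: self_concordant_barrier_def)
  show "convex_on (interior X) F" by (rule cv)
  fix x assume x: "x \<in> interior X"
  show "(F has_derivative (\<lambda>h. gradient F x \<bullet> h)) (at x)"
    using C3 x by (intro has_derivative_gradient) (simp add: C3_on_def)
  have g: "(gradient F has_derivative frechet_derivative (gradient F) (at x)) (at x)"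
    using C3 x by (simp add: C3_on_def frechet_derivative_works)
  then show "(gradient F has_derivative (\<lambda>h. hessian F x *v h)) (at x)"
    by (simp add: hessian_eq)
  have H: "(hessian F has_derivative frechet_derivative (hessian F) (at x)) (at x)"
    using C3 x by (simp add: C3_on_def frechet_derivative_works)
  have bl: "bounded_linear (\<lambda>M :: real^'n^'n. M *v k)" for k
    by (intro linear_conv_bounded_linear[THEN iffD1] linearI)
      (simp_all add: matrix_vector_mult_add_rdistrib scaleR_matrix_vector_assoc)
  show "((\<lambda>x. hessian F x *v k) has_derivative
      (\<lambda>w. frechet_derivative (hessian F) (at x) w *v k)) (at x)" for k
    by (rule bounded_linear.has_derivative[OF bl H])
  show "\<bar>(frechet_derivative (hessian F) (at x) h *v h) \<bullet> h\<bar> \<le> 2 * (h \<bullet> (hessian F x *v h)) powr (3/2)" for h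
    using bar x by (simp add: self_concordant_barrier_def third_deriv_def inner_commute)
next
  fix z assume "z \<in> frontier (interior X)"
  then show "filterlim F at_top (at z within interior X)"
    using bar frontier_interior_subset[of X] unfolding self_concordant_barrier_def by blast
qed

definition join :: "real^'n1 \<Rightarrow> real^'n2 \<Rightarrow> real^('n1::finite + 'n2::finite)" where
  "join u v = (\<chi> i. case i of Inl j \<Rightarrow> u $ j | Inr k \<Rightarrow> v $ k)"

lemma block_join [simp]: "block1 (join u v) = u" "block2 (join u v) = v"
  by (simp_all add: block1_def block2_def join_def vec_eq_iff)

lemma join_block: "join (block1 x) (block2 x) = x"
  by (simp add: block1_def block2_def join_def vec_eq_iff split: sum.split)

lemma bounded_linear_block: "bounded_linear block1" "bounded_linear block2"
  by (auto intro!: linear_conv_bounded_linear[THEN iffD1] linearI simp: block1_def block2_def vec_eq_iff)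

lemma bounded_linear_join: "bounded_linear (\<lambda>p. join (fst p) (snd p))"
  by (auto intro!: linear_conv_bounded_linear[THEN iffD1] linearI simp: join_def vec_eq_iff split: sum.split)

lemma inner_join: "join u v \<bullet> x = u \<bullet> block1 x + v \<bullet> block2 x"
proof -
  have "join u v \<bullet> x = (\<Sum>i\<in>UNIV <+> UNIV. join u v $ i * x $ i)"
    by (simp add: inner_vec_def)
  also have "\<dots> = u \<bullet> block1 x + v \<bullet> block2 x"
    by (subst sum.Plus) (simp_all add: inner_vec_def join_def block1_def block2_def)
  finally show ?thesis .
qed

lemma prod_set_eq_image: "prod_set S1 S2 = (\<lambda>p. join (fst p) (snd p)) ` (S1 \<times> S2)"
proof
  show "prod_set S1 S2 \<subseteq> (\<lambda>p. join (fst p) (snd p)) ` (S1 \<times> S2)"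
  proof
    fix x assume "x \<in> prod_set S1 S2"
    then have "(block1 x, block2 x) \<in> S1 \<times> S2" by (simp add: prod_set_def)
    moreover have "x = join (fst (block1 x, block2 x)) (snd (block1 x, block2 x))" by (simp add: join_block)
    ultimately show "x \<in> (\<lambda>p. join (fst p) (snd p)) ` (S1 \<times> S2)" by blast
  qed
qed (auto simp: prod_set_def)

lemma open_prod_set:
  assumes "open S1" "open S2"
  shows "open (prod_set S1 S2)"
proof -
  have "prod_set S1 S2 = block1 -` S1 \<inter> block2 -` S2" by (auto simp: prod_set_def)
  then show ?thesis
    using assms linear_continuous_on[OF bounded_linear_block(1)] linear_continuous_on[OF bounded_linear_block(2)]
    by (auto intro!: open_Int open_vimage)
qed

lemma interior_prod_set: "interior (prod_set X1 X2) = prod_set (interior X1) (interior X2)"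
proof (rule interior_unique)
  show "prod_set (interior X1) (interior X2) \<subseteq> prod_set X1 X2"
    using interior_subset[of X1] interior_subset[of X2] by (auto simp: prod_set_def)
  show "open (prod_set (interior X1) (interior X2))" by (simp add: open_prod_set)
  fix U assume U: "U \<subseteq> prod_set X1 X2" "open U"
  have "open (block1 ` U)" "open (block2 ` U)"
    using U(2) bounded_linear_block[THEN bounded_linear.linear]
    by (auto intro!: open_surjective_linear_image surjI[where f = "\<lambda>u. join u 0"] surjI[where f = "\<lambda>u. join 0 u"])
  moreover have "block1 ` U \<subseteq> X1" "block2 ` U \<subseteq> X2" using U by (auto simp: prod_set_def)
  ultimately have "block1 ` U \<subseteq> interior X1" "block2 ` U \<subseteq> interior X2"
    by (simp_all add: interior_maximal)
  then show "U \<subseteq> prod_set (interior X1) (interior X2)"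
    by (auto simp: prod_set_def)
qed

text \<open>
  For the third derivative, \<open>p\<^sup>3\<^sup>/\<^sup>2 + q\<^sup>3\<^sup>/\<^sup>2 \<le> (p + q)\<^sup>3\<^sup>/\<^sup>2\<close>.  At a frontier point of the product one of the
  two summands tends to infinity, and the other is bounded below because it attains its minimum.
\<close>

lemma self_concordant_sum:
  assumes "self_concordant D1 F1 G1 H1 T1" and "self_concordant D2 F2 G2 H2 T2"
  shows "self_concordant (prod_set D1 D2) (sum_fun F1 F2)
    (\<lambda>x. join (G1 (block1 x)) (G2 (block2 x)))
    (\<lambda>x h. join (H1 (block1 x) (block1 h)) (H2 (block2 x) (block2 h)))
    (\<lambda>x w k. join (T1 (block1 x) (block1 w) (block1 k)) (T2 (block2 x) (block2 w) (block2 k)))"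
proof -
  interpret sc1: self_concordant D1 F1 G1 H1 T1 by fact
  interpret sc2: self_concordant D2 F2 G2 H2 T2 by fact
  have b1: "(block1 has_derivative block1) (at x)" and b2: "(block2 has_derivative block2) (at x)"
    for x :: "real^('a + 'b)"
    using bounded_linear_imp_has_derivative bounded_linear_block by blast+
  have join_deriv: "((\<lambda>x. join (f x) (g x)) has_derivative (\<lambda>h. join (f' h) (g' h))) (at x)"
    if "(f has_derivative f') (at x)" "(g has_derivative g') (at x)"
    for f f' g g' and x :: "real^('a + 'b)"
    using bounded_linear.has_derivative[OF bounded_linear_join has_derivative_Pair[OF that]] by simp
  show ?thesis
  proof
    show "open (prod_set D1 D2)" by (rule open_prod_set[OF sc1.open_D sc2.open_D])
    show "convex (prod_set D1 D2)"
      unfolding prod_set_eq_image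
      by (intro convex_linear_image bounded_linear.linear[OF bounded_linear_join] convex_Times
          sc1.convex_D sc2.convex_D)
    show "bounded (prod_set D1 D2)"
      unfolding prod_set_eq_image
      by (intro bounded_linear_image bounded_Times sc1.bounded_D sc2.bounded_D bounded_linear_join)
    show "prod_set D1 D2 \<noteq> {}"
      using sc1.D_ne sc2.D_ne by (simp add: prod_set_eq_image)
    show "convex_on (prod_set D1 D2) (sum_fun F1 F2)"
      unfolding convex_on_def
    proof (intro conjI ballI allI impI)
      show "convex (prod_set D1 D2)" by fact
      fix x y and u v :: real
      assume xy: "x \<in> prod_set D1 D2" "y \<in> prod_set D1 D2" and uv: "0 \<le> u" "0 \<le> v" "u + v = 1"
      have b: "block1 (u *\<^sub>R x + v *\<^sub>R y) = u *\<^sub>R block1 x + v *\<^sub>R block1 y"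
        "block2 (u *\<^sub>R x + v *\<^sub>R y) = u *\<^sub>R block2 x + v *\<^sub>R block2 y"
        by (simp_all add: block1_def block2_def vec_eq_iff)
      have "F1 (u *\<^sub>R block1 x + v *\<^sub>R block1 y) \<le> u * F1 (block1 x) + v * F1 (block1 y)"
        using sc1.convex_F xy uv by (auto simp: convex_on_def prod_set_def)
      moreover have "F2 (u *\<^sub>R block2 x + v *\<^sub>R block2 y) \<le> u * F2 (block2 x) + v * F2 (block2 y)"
        using sc2.convex_F xy uv by (auto simp: convex_on_def prod_set_def)
      ultimately show "sum_fun F1 F2 (u *\<^sub>R x + v *\<^sub>R y) \<le> u * sum_fun F1 F2 x + v * sum_fun F1 F2 y"
        by (simp add: sum_fun_def b algebra_simps)
    qed
  next
    fix x :: "real^('a + 'b)" assume "x \<in> prod_set D1 D2"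
    then have x: "block1 x \<in> D1" "block2 x \<in> D2" by (auto simp: prod_set_def)
    show "(sum_fun F1 F2 has_derivative (\<lambda>h. join (G1 (block1 x)) (G2 (block2 x)) \<bullet> h)) (at x)"
      unfolding sum_fun_def inner_join
      by (intro has_derivative_add has_derivative_compose[OF b1 sc1.F_deriv]
          has_derivative_compose[OF b2 sc2.F_deriv] x)
    show "((\<lambda>x. join (G1 (block1 x)) (G2 (block2 x))) has_derivative
        (\<lambda>h. join (H1 (block1 x) (block1 h)) (H2 (block2 x) (block2 h)))) (at x)"
      by (intro join_deriv has_derivative_compose[OF b1 sc1.G_deriv]
          has_derivative_compose[OF b2 sc2.G_deriv] x)
    show "((\<lambda>x. join (H1 (block1 x) (block1 k)) (H2 (block2 x) (block2 k))) has_derivative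
        (\<lambda>w. join (T1 (block1 x) (block1 w) (block1 k)) (T2 (block2 x) (block2 w) (block2 k)))) (at x)" for k
      by (intro join_deriv has_derivative_compose[OF b1 sc1.H_deriv]
          has_derivative_compose[OF b2 sc2.H_deriv] x)
    show "\<bar>join (T1 (block1 x) (block1 h) (block1 h)) (T2 (block2 x) (block2 h) (block2 h)) \<bullet> h\<bar>
        \<le> 2 * (h \<bullet> join (H1 (block1 x) (block1 h)) (H2 (block2 x) (block2 h))) powr (3/2)" for h
    proof -
      let ?p = "block1 h \<bullet> H1 (block1 x) (block1 h)" and ?q = "block2 h \<bullet> H2 (block2 x) (block2 h)"
      have pq: "0 \<le> ?p" "0 \<le> ?q" using sc1.psd sc2.psd x by auto
      have "\<bar>join (T1 (block1 x) (block1 h) (block1 h)) (T2 (block2 x) (block2 h) (block2 h)) \<bullet> h\<bar>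
          \<le> 2 * ?p powr (3/2) + 2 * ?q powr (3/2)"
        unfolding inner_join
        using sc1.third_bound[OF x(1), of "block1 h"] sc2.third_bound[OF x(2), of "block2 h"] by linarith
      also have "\<dots> = 2 * (?p * sqrt ?p + ?q * sqrt ?q)"
        using pq by (simp add: powr_three_halves)
      also have "\<dots> \<le> 2 * (?p * sqrt (?p + ?q) + ?q * sqrt (?p + ?q))"
        using pq by (intro mult_left_mono add_mono) auto
      also have "\<dots> = 2 * (?p + ?q) powr (3/2)"
        using pq by (simp add: powr_three_halves distrib_right)
      also have "?p + ?q = h \<bullet> join (H1 (block1 x) (block1 h)) (H2 (block2 x) (block2 h))"
        by (simp add: inner_commute[of h] inner_join) (simp add: inner_commute)
      finally show ?thesis .
    qed
  next
    fix z :: "real^('a + 'b)" assume z: "z \<in> frontier (prod_set D1 D2)"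
    then have zc: "z \<in> closure (prod_set D1 D2)" and zn: "z \<notin> prod_set D1 D2"
      using open_prod_set[OF sc1.open_D sc2.open_D] by (auto simp: frontier_def interior_open)
    have lim: "(block1 \<longlongrightarrow> block1 z) (at z within prod_set D1 D2)"
        "(block2 \<longlongrightarrow> block2 z) (at z within prod_set D1 D2)"
      by (intro bounded_linear.tendsto[OF bounded_linear_block(1)] bounded_linear.tendsto[OF bounded_linear_block(2)] tendsto_ident_at)+
    have ev: "\<forall>\<^sub>F x in at z within prod_set D1 D2. x \<in> prod_set D1 D2"
      by (simp add: eventually_at_filter)
    obtain m1 where m1: "\<And>x. x \<in> D1 \<Longrightarrow> m1 \<le> F1 x"
      using sc1.minimizer_exists[of 0] by auto
    obtain m2 where m2: "\<And>x. x \<in> D2 \<Longrightarrow> m2 \<le> F2 x"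
      using sc2.minimizer_exists[of 0] by auto
    have cl: "block1 z \<in> closure D1" "block2 z \<in> closure D2"
    proof -
      obtain X where X: "\<And>n. X n \<in> prod_set D1 D2" "X \<longlonglongrightarrow> z"
        using zc closure_sequential by blast
      then have "(\<lambda>n. block1 (X n)) \<longlonglongrightarrow> block1 z" "(\<lambda>n. block2 (X n)) \<longlonglongrightarrow> block2 z"
        using bounded_linear.tendsto bounded_linear_block by blast+
      moreover have "block1 (X n) \<in> D1" "block2 (X n) \<in> D2" for n
        using X(1) by (auto simp: prod_set_def)
      ultimately show "block1 z \<in> closure D1" "block2 z \<in> closure D2"
        unfolding closure_sequential by (metis (no_types, lifting))+
    qed
    consider "block1 z \<notin> D1" | "block2 z \<notin> D2"
      using zn by (auto simp: prod_set_def)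
    then show "filterlim (sum_fun F1 F2) at_top (at z within prod_set D1 D2)"
    proof cases
      case 1
      then have "block1 z \<in> frontier D1"
        using cl sc1.open_D by (simp add: frontier_def interior_open)
      moreover have "filterlim block1 (at (block1 z) within D1) (at z within prod_set D1 D2)"
        unfolding filterlim_at using lim(1) ev 1 by (auto simp: prod_set_def elim!: eventually_mono)
      ultimately have "filterlim (\<lambda>x. F1 (block1 x)) at_top (at z within prod_set D1 D2)"
        by (intro filterlim_compose[OF sc1.barrier])
      then have "filterlim (\<lambda>x. m2 + F1 (block1 x)) at_top (at z within prod_set D1 D2)"
        by (intro filterlim_tendsto_add_at_top[OF tendsto_const])
      then show ?thesis
        by (rule filterlim_at_top_mono) (use ev m2 in \<open>auto simp: prod_set_def sum_fun_def elim!: eventually_mono\<close>)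
    next
      case 2
      then have "block2 z \<in> frontier D2"
        using cl sc2.open_D by (simp add: frontier_def interior_open)
      moreover have "filterlim block2 (at (block2 z) within D2) (at z within prod_set D1 D2)"
        unfolding filterlim_at using lim(2) ev 2 by (auto simp: prod_set_def elim!: eventually_mono)
      ultimately have "filterlim (\<lambda>x. F2 (block2 x)) at_top (at z within prod_set D1 D2)"
        by (intro filterlim_compose[OF sc2.barrier])
      then have "filterlim (\<lambda>x. m1 + F2 (block2 x)) at_top (at z within prod_set D1 D2)"
        by (intro filterlim_tendsto_add_at_top[OF tendsto_const])
      then show ?thesis
        by (rule filterlim_at_top_mono) (use ev m1 in \<open>auto simp: prod_set_def sum_fun_def elim!: eventually_mono\<close>)
    qed
  qed
qed

section \<open>The inexact Newton decrement\<close>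

lemma matrix_inv_vector:
  fixes M :: "real^'n^'n"
  assumes "\<And>v. M *v v = 0 \<Longrightarrow> v = 0"
  shows "M *v (matrix_inv M *v w) = w"
proof -
  have "inj ((*v) M)"
    using assms by (metis linear_injective_0 matrix_vector_mul_linear)
  then have "invertible M"
    by (simp add: invertible_left_inverse matrix_left_invertible_injective)
  then have "M ** matrix_inv M = mat 1"
    unfolding invertible_def matrix_inv_def by (rule someI2_ex) simp
  then show ?thesis by (simp add: matrix_vector_mul_assoc)
qed

text \<open>
  The equations say that \<open>u\<close> is the solution of the least-norm problem with constraint
  \<open>A z = A x - b\<close>, where \<open>x = xbar y t\<close>, and that the Newton step subtracts from \<open>y\<close> exactly \<open>t\<close> times its Lagrange multiplier.
  Minimality follows since \<open>z - u\<close> is orthogonal to \<open>u\<close> in the local inner product for every feasible \<open>z\<close>.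
\<close>

lemma inexact_decrement_direction:
  fixes A :: "real^'n^'m" and xbar :: "real^'m \<Rightarrow> real \<Rightarrow> real^'n" and F y t
  defines "N \<equiv> local_norm F (xbar y t)" and "M \<equiv> hessian F (xbar y t)"
  assumes sym: "\<And>u v. u \<bullet> (M *v v) = v \<bullet> (M *v u)" and pd: "\<And>v. v \<noteq> 0 \<Longrightarrow> 0 < v \<bullet> (M *v v)"
    and A: "surj ((*v) A)" and t: "0 < t"
  obtains u where "A *v u = A *v xbar y t - b"
    "M *v u = (1 / t) *\<^sub>R (transpose A *v (y - newton_step F A b xbar y t))"
    "inexact_decrement F A b xbar y t = N u"
    "\<And>z. A *v z = A *v xbar y t - b \<Longrightarrow> inexact_decrement F A b xbar y t \<le> N z"
proof -
  define S where "S = inexact_hess F A xbar y t"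
  define g where "g = inexact_grad A b xbar y t"
  define w where "w = matrix_inv S *v g"
  define u where "u = (1 / t) *\<^sub>R (matrix_inv M *v (transpose A *v w))"
  have Minv: "M *v (matrix_inv M *v k) = k" for k
    by (rule matrix_inv_vector) (use pd in fastforce)
  have S: "S *v v = (1 / t) *\<^sub>R (A *v (matrix_inv M *v (transpose A *v v)))" for v
    by (simp only: S_def inexact_hess_def M_def scaleR_matrix_vector_assoc[symmetric] matrix_vector_mul_assoc matrix_mul_assoc)
  have adj: "(transpose A *v v) \<bullet> k = v \<bullet> (A *v k)" for v k
    by (simp add: dot_lmul_matrix)
  have Sw: "S *v w = g"
    unfolding w_def
  proof (rule matrix_inv_vector)
    fix v assume "S *v v = 0"
    then have "A *v (matrix_inv M *v (transpose A *v v)) = 0" using t by (simp only: S) simp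
    then have "(transpose A *v v) \<bullet> (matrix_inv M *v (transpose A *v v)) = 0"
      unfolding adj by simp
    then have "matrix_inv M *v (transpose A *v v) = 0"
      using pd[of "matrix_inv M *v (transpose A *v v)"] unfolding Minv by (metis inner_commute less_irrefl)
    then have "transpose A *v v = 0"
      using Minv[of "transpose A *v v"] by (metis matrix_vector_mult_0_right)
    then have "v \<bullet> (A *v k) = 0" for k unfolding adj[symmetric] by simp
    then have "v \<bullet> v = 0" using A by (metis surjD)
    then show "v = 0" by simp
  qed
  have Au: "A *v u = g"
    using Sw unfolding S u_def by (simp only: matrix_vector_mult_scaleR)
  have Mu: "M *v u = (1 / t) *\<^sub>R (transpose A *v w)"
    unfolding u_def by (simp only: matrix_vector_mult_scaleR Minv)
  have zMu: "z \<bullet> (M *v u) = (1 / t) * (g \<bullet> w)" if "A *v z = g" for z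
    using adj[of w z] that unfolding Mu by (simp only: inner_scaleR_right inner_commute)
  have dec: "inexact_decrement F A b xbar y t = sqrt (u \<bullet> (M *v u))"
    unfolding zMu[OF Au] by (simp add: inexact_decrement_def g_def w_def S_def)
  show ?thesis
  proof (rule that[of u])
    show "A *v u = A *v xbar y t - b" using Au by (simp add: g_def inexact_grad_def)
    have "w = y - newton_step F A b xbar y t"
      by (simp add: newton_step_def w_def g_def S_def)
    then show "M *v u = (1 / t) *\<^sub>R (transpose A *v (y - newton_step F A b xbar y t))"
      using Mu by simp
    show "inexact_decrement F A b xbar y t = N u"
      using dec by (simp add: N_def local_norm_def M_def)
    fix z assume "A *v z = A *v xbar y t - b"
    then have z: "z \<bullet> (M *v u) = u \<bullet> (M *v u)"
      using zMu[OF Au] zMu[of z] by (simp add: g_def inexact_grad_def)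
    have "0 \<le> (z - u) \<bullet> (M *v (z - u))"
      using pd[of "z - u"] by (cases "z = u") auto
    also have "\<dots> = z \<bullet> (M *v z) - u \<bullet> (M *v u)"
      using z sym[of u z] by (simp add: matrix_vector_mult_diff_distrib inner_diff_left inner_diff_right)
    finally have "sqrt (u \<bullet> (M *v u)) \<le> sqrt (z \<bullet> (M *v z))"
      by (intro real_sqrt_le_mono) simp
    then show "inexact_decrement F A b xbar y t \<le> N z"
      unfolding dec by (simp add: N_def local_norm_def M_def)
  qed
qed

section \<open>One step of the iteration\<close>

lemma self_concordant_hessian:
  fixes F :: "real^'n \<Rightarrow> real"
  assumes sc: "self_concordant D F G H T" and x: "x \<in> D"
  shows "hessian F x *v h = H x h"
proof (rule hessian_eq)
  interpret self_concordant D F G H T by (rule sc)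
  show "(gradient F has_derivative H x) (at x)"
    by (rule has_derivative_transform_within_open[OF G_deriv[OF x] open_D x])
      (rule gradient_eq[OF F_deriv, symmetric])
qed

lemma self_concordant_local_norm:
  fixes F :: "real^'n \<Rightarrow> real"
  assumes sc: "self_concordant D F G H T" and x: "x \<in> D"
  shows "local_norm F x h = self_concordant.N H x h"
  by (simp add: local_norm_def self_concordant.N_def[OF sc] self_concordant_hessian[OF sc x])

text \<open>
  Up to a constant the objective is a negative multiple of \<open>F\<close> minus a linear function, so its maximizers are the points where the
  gradient of \<open>F\<close> has the prescribed value, and there is exactly one.
\<close>

lemma x_star_characterization:
  fixes F :: "real^'n \<Rightarrow> real" and A :: "real^'n^'m"
  assumes sc: "self_concordant (interior X) F G H T" and t: "0 < t"
  shows "x_star X F A b c y t \<in> interior X"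
    "G (x_star X F A b c y t) = (1 / t) *\<^sub>R (c + transpose A *v y)"
proof -
  interpret self_concordant "interior X" F G H T by (rule sc)
  let ?s = "(1 / t) *\<^sub>R (c + transpose A *v y)"
  let ?obj = "\<lambda>x. lagrangian A b c y x - t * F x"
  have obj: "?obj x = - t * (F x - ?s \<bullet> x) - y \<bullet> b" for x
    using t by (simp add: lagrangian_def dot_lmul_matrix inner_add_left inner_diff_right algebra_simps)
  have iff: "is_arg_max ?obj (\<lambda>x. x \<in> interior X) x \<longleftrightarrow> x \<in> interior X \<and> G x = ?s" for x
  proof -
    have "?obj x < ?obj z \<longleftrightarrow> F z - ?s \<bullet> z < F x - ?s \<bullet> x" for z
      unfolding obj using t by simp
    then have "is_arg_max ?obj (\<lambda>x. x \<in> interior X) x \<longleftrightarrow>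
        x \<in> interior X \<and> (\<forall>z\<in>interior X. F x - ?s \<bullet> x \<le> F z - ?s \<bullet> z)"
      unfolding is_arg_max_def by (simp only: not_less[symmetric]) blast
    then show ?thesis using minimizer_iff by blast
  qed
  obtain x where x: "x \<in> interior X" "G x = ?s" using G_surj by blast
  have "x_star X F A b c y t = x"
    unfolding x_star_def iff by (rule the_equality) (use x G_inj in auto)
  then show "x_star X F A b c y t \<in> interior X" "G (x_star X F A b c y t) = ?s"
    using x by simp_all
qed

lemma local_norm_shrink:
  assumes sc: "self_concordant D F G H T" and "x \<in> D" "y \<in> D" "self_concordant.N H x (y - x) \<le> r" "r < 1"
  shows "(1 - r) * self_concordant.N H y h \<le> self_concordant.N H x h"
proof -
  interpret self_concordant D F G H T by (rule sc)
  have "(1 - r) * N y h \<le> (1 - N x (y - x)) * N y h"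
    using assms by (intro mult_right_mono) auto
  also have "\<dots> \<le> N x h" using assms by (intro local_norm_compare) auto
  finally show ?thesis .
qed

text \<open>
  The difference of the two sides is \<open>\<delta>\<^sup>2 / (1 - \<delta>)\<close>.  The left-hand side collects the coefficient of \<open>\<theta>\<close>
  in \<open>inexact_newton_estimate\<close>.
\<close>

lemma inexactness_le_p_coef:
  assumes "0 \<le> \<delta>" "\<delta> < 1"
  shows "\<delta> + (1 / (1 - \<delta>)^2 - 1) \<le> p_coef \<delta>"
proof -
  have "(1 - k) * (1 / k^2 + 2 / k) - ((1 - k) + (1 / k^2 - 1)) = (1 - k)^2 / k" if "0 < k" for k :: real
    using that by (simp add: field_simps power2_eq_square)
  from this[of "1 - \<delta>"] have "p_coef \<delta> - (\<delta> + (1 / (1 - \<delta>)^2 - 1)) = \<delta>^2 / (1 - \<delta>)"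
    using assms by (simp add: p_coef_def)
  moreover have "0 \<le> \<delta>^2 / (1 - \<delta>)" using assms by simp
  ultimately show ?thesis by linarith
qed

lemma inexact_newton_step_keeps_decrement:
  fixes F :: "real^'n \<Rightarrow> real" and A :: "real^'n^'m" and xbar :: "real^'m \<Rightarrow> real \<Rightarrow> real^'n"
    and b y :: "real^'m" and c :: "real^'n"
  assumes sc: "self_concordant (interior X) F G H T" and A: "surj ((*v) A)"
    and xbar: "\<And>y t. 0 < t \<Longrightarrow> xbar y t \<in> interior X"
    and \<delta>: "0 \<le> \<delta>" "\<delta> < 1" and \<beta>: "0 < \<beta>" "\<beta> < 1 - \<delta>" and pos: "cubic \<delta> \<beta> > 0"
    and t: "0 < t" and tp: "0 < tp"
  defines "xs \<equiv> x_star X F A b c" and "yp \<equiv> newton_step F A b xbar y tp"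
  assumes dp: "local_norm F (xs yp tp) (xbar yp tp - xs yp tp) \<le> \<delta>"
    and d1: "local_norm F (xs y tp) (xbar y tp - xs y tp) \<le> \<delta>"
    and D: "local_norm F (xbar y t) (xbar y tp - xbar y t) \<le> Delta_bar \<delta> \<beta>"
    and dec: "inexact_decrement F A b xbar y t \<le> \<beta>"
  shows "inexact_decrement F A b xbar yp tp \<le> \<beta>"
proof -
  interpret self_concordant "interior X" F G H T by (rule sc)
  note hess = self_concordant_hessian[OF sc] and norm = self_concordant_local_norm[OF sc]
  note star = x_star_characterization[OF sc, where A = A and b = b and c = c, folded xs_def]
  note theta = theta_properties[OF \<delta> \<beta> pos]
  let ?xb = "xbar y t" and ?x1b = "xbar y tp" and ?xpb = "xbar yp tp"
  let ?x1 = "xs y tp" and ?xp = "xs yp tp"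
  have in_X: "?xb \<in> interior X" "?x1b \<in> interior X" "?xpb \<in> interior X" "?x1 \<in> interior X" "?xp \<in> interior X"
    using xbar star(1) t tp by auto
  have sym: "u \<bullet> (hessian F x *v v) = v \<bullet> (hessian F x *v u)" if "x \<in> interior X" for x u v
    using H_sym[OF that] by (simp add: hess that)
  have pd: "0 < v \<bullet> (hessian F x *v v)" if "x \<in> interior X" "v \<noteq> 0" for x v
    using nondegenerate[OF that] by (simp add: hess that)
  have direction: "\<exists>u. A *v u = A *v xbar y t - b
      \<and> H (xbar y t) u = (1 / t) *\<^sub>R (transpose A *v (y - newton_step F A b xbar y t))
      \<and> inexact_decrement F A b xbar y t = N (xbar y t) u
      \<and> (\<forall>z. A *v z = A *v xbar y t - b \<longrightarrow> inexact_decrement F A b xbar y t \<le> N (xbar y t) z)"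
    if t: "0 < t" for y t
  proof -
    note x = xbar[OF t, of y]
    show ?thesis
    proof (rule inexact_decrement_direction[where F = F and xbar = xbar and y = y and t = t and A = A and b = b])
      show "u \<bullet> (hessian F (xbar y t) *v v) = v \<bullet> (hessian F (xbar y t) *v u)" for u v
        by (rule sym[OF x])
      show "0 < v \<bullet> (hessian F (xbar y t) *v v)" if "v \<noteq> 0" for v
        by (rule pd[OF x that])
      fix u
      assume "A *v u = A *v xbar y t - b"
        and "hessian F (xbar y t) *v u = (1 / t) *\<^sub>R (transpose A *v (y - newton_step F A b xbar y t))"
        and "inexact_decrement F A b xbar y t = local_norm F (xbar y t) u"
        and "\<And>z. A *v z = A *v xbar y t - b \<Longrightarrow> inexact_decrement F A b xbar y t \<le> local_norm F (xbar y t) z"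
      then show ?thesis
        unfolding hess[OF x] norm[OF x] by (intro exI[of _ u] conjI allI impI)
    qed (fact A t)+
  qed
  obtain u0 where u0: "A *v u0 = A *v ?xb - b" "inexact_decrement F A b xbar y t = N ?xb u0"
    using direction[OF t, of y] by metis
  obtain u1 where u1: "A *v u1 = A *v ?x1b - b"
      "H ?x1b u1 = (1 / tp) *\<^sub>R (transpose A *v (y - yp))"
      "inexact_decrement F A b xbar y tp = N ?x1b u1"
    and min1: "\<And>z. A *v z = A *v ?x1b - b \<Longrightarrow> inexact_decrement F A b xbar y tp \<le> N ?x1b z"
    using direction[OF tp, of y] unfolding yp_def[symmetric] by metis
  have minp: "inexact_decrement F A b xbar yp tp \<le> N ?xpb z" if "A *v z = A *v ?xpb - b" for z
    using direction[OF tp, of yp] that by metis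
  define l where "l = N ?x1b u1"
  define \<Delta> where "\<Delta> = N ?xb (?x1b - ?xb)"
  have \<Delta>: "0 \<le> \<Delta>" "\<Delta> \<le> Delta_bar \<delta> \<beta>" using D in_X by (auto simp: \<Delta>_def norm)
  have l0: "0 \<le> l" using in_X by (simp add: l_def)
  have \<Delta>1: "\<Delta> < 1"
    by (rule step_bound_le_theta(1)[OF \<delta> \<beta> theta(1) \<Delta>, of 0]) (use \<beta> \<Delta> in auto)
  have l1: "l * (1 - \<Delta>) \<le> \<beta> + \<Delta>"
  proof -
    \<comment> \<open>The difference of the new approximation and the point that was nearest to the old one.\<close>
    let ?z = "(?x1b - ?xb) + u0"
    have "l \<le> N ?x1b ?z"
      using min1[of ?z] u0 u1(3) by (simp add: l_def matrix_vector_right_distrib matrix_vector_mult_diff_distrib)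
    then have "l * (1 - \<Delta>) \<le> (1 - \<Delta>) * N ?x1b ?z" using \<Delta>1 by (simp add: mult.commute)
    also have "\<dots> \<le> N ?xb ?z"
      by (rule local_norm_shrink[OF sc in_X(1,2) _ \<Delta>1]) (simp add: \<Delta>_def)
    also have "\<dots> \<le> \<Delta> + N ?xb u0" unfolding \<Delta>_def by (rule N_triangle[OF in_X(1)])
    finally show ?thesis using dec u0(2) by simp
  qed
  note l = step_bound_le_theta(2,3)[OF \<delta> \<beta> theta(1) \<Delta> l0 l1]
  define \<theta>1 where "\<theta>1 = l / (1 - \<delta> - l)"
  have \<theta>1: "0 \<le> \<theta>1" "\<theta>1 \<le> theta \<delta> \<beta>" using l l0 by (auto simp: \<theta>1_def)
  define u where "u = - u1"
  have "H ?x1b u = G ?xp - G ?x1"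
    using in_X tp by (simp add: u_def H_simps u1(2) star(2) vector_matrix_mult_diff_distrib
      flip: scaleR_minus_right scaleR_diff_right)
  moreover have Nu: "N ?x1b u = l" by (simp add: u_def l_def N_minus in_X)
  ultimately have est: "N ?xp (?xp - ?x1b - u) \<le> \<delta> * (1 + \<theta>1) + \<theta>1^2 + (1 / (1 - \<delta>)^2 - 1) * \<theta>1"
    using inexact_newton_estimate[OF in_X(4,2,5) _ \<delta>(2), of u] d1 l in_X by (simp add: norm \<theta>1_def)
  \<comment> \<open>The difference of the new approximation and the feasible point \<open>?x1b + u\<close>.\<close>
  let ?z = "(?xpb - ?xp) + (?xp - ?x1b - u)"
  have "inexact_decrement F A b xbar yp tp \<le> N ?xpb ?z"
    by (rule minp) (simp add: u_def u1(1) matrix_vector_right_distrib matrix_vector_mult_diff_distrib)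
  then have "(1 - \<delta>) * inexact_decrement F A b xbar yp tp \<le> (1 - \<delta>) * N ?xpb ?z"
    using \<delta> by simp
  also have "\<dots> \<le> N ?xp ?z"
    by (rule local_norm_shrink[OF sc in_X(5,3) _ \<delta>(2)]) (use dp in_X in \<open>simp add: norm\<close>)
  also have "\<dots> \<le> N ?xp (?xpb - ?xp) + N ?xp (?xp - ?x1b - u)" by (rule N_triangle[OF in_X(5)])
  also have "\<dots> \<le> \<delta> + (\<delta> * (1 + \<theta>1) + \<theta>1^2 + (1 / (1 - \<delta>)^2 - 1) * \<theta>1)"
    using dp est in_X by (intro add_mono) (simp_all add: norm)
  also have "\<dots> = 2 * \<delta> + (\<theta>1^2 + (\<delta> + (1 / (1 - \<delta>)^2 - 1)) * \<theta>1)"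
    by (simp only: distrib_left distrib_right mult_1_right mult_2 add_ac)
  also have "\<dots> \<le> 2 * \<delta> + ((theta \<delta> \<beta>)^2 + p_coef \<delta> * theta \<delta> \<beta>)"
  proof -
    have "0 \<le> p_coef \<delta>" using \<delta> by (simp add: p_coef_def)
    then show ?thesis
      using \<theta>1 inexactness_le_p_coef[OF \<delta>] by (intro add_left_mono add_mono power_mono mult_mono) auto
  qed
  also have "\<dots> = (1 - \<delta>) * \<beta>" unfolding theta(2) by (simp add: q_coef_def)
  finally show ?thesis using \<delta> by simp
qed

theorem theorem4p3:
  fixes \<delta> :: real
    and X1 :: "(real^'n1) set" and X2 :: "(real^'n2) set"
    and F1 :: "real^'n1 \<Rightarrow> real" and F2 :: "real^'n2 \<Rightarrow> real"
    and \<nu>1 \<nu>2 :: real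
    and A :: "real^('n1::finite + 'n2::finite)^'m" and b :: "real^'m"
    and c :: "real^('n1 + 'n2)"
    and Y :: "(real^'m) set"
    and xbar :: "real^'m \<Rightarrow> real \<Rightarrow> real^('n1 + 'n2)"
  assumes "0 \<le> \<delta>" and "\<delta> \<le> delta_max"
  shows "\<exists>\<beta>lo \<beta>hi \<beta>3.
    0 \<le> \<beta>lo \<and> \<beta>lo < \<beta>hi \<and> \<beta>hi < \<beta>3 \<and> {\<beta>. cubic \<delta> \<beta> = 0} = {\<beta>lo, \<beta>hi, \<beta>3} \<and>
    (let X = prod_set X1 X2; F = sum_fun F1 F2; xs = x_star X F A b c in
     decomposition_setting X1 X2 F1 F2 \<nu>1 \<nu>2 A b c Y \<longrightarrow>
     (\<forall>y t. t > 0 \<longrightarrow> xbar y t \<in> interior X) \<longrightarrow>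
     (\<forall>\<beta>\<in>{\<beta>lo<..<\<beta>hi}. Delta_bar \<delta> \<beta> > 0 \<longrightarrow>
       (\<forall>y\<in>Y. \<forall>t>0. \<forall>\<Delta>t>0.
         let tp = t - \<Delta>t; yp = newton_step F A b xbar y tp in
           tp > 0 \<longrightarrow>
           local_norm F (xs yp tp) (xbar yp tp - xs yp tp) \<in> {0..\<delta>} \<longrightarrow>
           local_norm F (xs y tp) (xbar y tp - xs y tp) \<in> {0..\<delta>} \<longrightarrow>
           local_norm F (xbar y t) (xbar y tp - xbar y t) \<in> {0..Delta_bar \<delta> \<beta>} \<longrightarrow>
           inexact_decrement F A b xbar y t \<le> \<beta> \<longrightarrow>
           inexact_decrement F A b xbar yp tp \<le> \<beta>)))"
proof -
  obtain lo hi r where roots: "0 \<le> lo" "lo < hi" "hi < 1 - \<delta>" "hi < r"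
    "{\<beta>. cubic \<delta> \<beta> = 0} = {lo, hi, r}" "\<And>\<beta>. lo < \<beta> \<Longrightarrow> \<beta> < hi \<Longrightarrow> cubic \<delta> \<beta> > 0"
    using cubic_three_roots[OF assms] by metis
  show ?thesis
  proof (intro exI[of _ lo] exI[of _ hi] exI[of _ r] conjI roots(1-5), unfold Let_def,
      intro impI ballI allI)
    fix \<beta> t \<Delta>t :: real and y
    let ?F = "sum_fun F1 F2" and ?tp = "t - \<Delta>t"
    let ?xs = "x_star (prod_set X1 X2) ?F A b c" and ?yp = "newton_step ?F A b xbar y ?tp"
    assume setting: "decomposition_setting X1 X2 F1 F2 \<nu>1 \<nu>2 A b c Y"
      and xbar: "\<forall>y t. t > 0 \<longrightarrow> xbar y t \<in> interior (prod_set X1 X2)"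
      and \<beta>: "\<beta> \<in> {lo<..<hi}" and t: "0 < t" "0 < ?tp"
      and step: "local_norm ?F (?xs ?yp ?tp) (xbar ?yp ?tp - ?xs ?yp ?tp) \<in> {0..\<delta>}"
        "local_norm ?F (?xs y ?tp) (xbar y ?tp - ?xs y ?tp) \<in> {0..\<delta>}"
        "local_norm ?F (xbar y t) (xbar y ?tp - xbar y t) \<in> {0..Delta_bar \<delta> \<beta>}"
        "inexact_decrement ?F A b xbar y t \<le> \<beta>"
    have sc: "self_concordant (interior (prod_set X1 X2)) (sum_fun F1 F2)
        (\<lambda>x. join (gradient F1 (block1 x)) (gradient F2 (block2 x)))
        (\<lambda>x h. join (hessian F1 (block1 x) *v block1 h) (hessian F2 (block2 x) *v block2 h))
        (\<lambda>x w k. join (frechet_derivative (hessian F1) (at (block1 x)) (block1 w) *v block1 k)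
          (frechet_derivative (hessian F2) (at (block2 x)) (block2 w) *v block2 k))"
      using setting unfolding interior_prod_set
      by (intro self_concordant_sum self_concordant_of_barrier) (auto simp: decomposition_setting_def)
    have A: "surj ((*v) A)"
      using setting by (simp add: decomposition_setting_def full_rank_surjective)
    have bounds: "\<delta> < 1" "0 < \<beta>" "\<beta> < 1 - \<delta>" "cubic \<delta> \<beta> > 0"
      using roots(1,3,6) assms \<beta> by (auto simp: delta_max_def)
    have step': "local_norm ?F (?xs ?yp ?tp) (xbar ?yp ?tp - ?xs ?yp ?tp) \<le> \<delta>"
        "local_norm ?F (?xs y ?tp) (xbar y ?tp - ?xs y ?tp) \<le> \<delta>"
        "local_norm ?F (xbar y t) (xbar y ?tp - xbar y t) \<le> Delta_bar \<delta> \<beta>"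
      using step(1-3) by (simp_all only: atLeastAtMost_iff)
    show "inexact_decrement ?F A b xbar ?yp ?tp \<le> \<beta>"
      by (rule inexact_newton_step_keeps_decrement[OF sc A _ assms(1) bounds t step' step(4)]) (rule xbar[rule_format])
  qed
qed

end
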